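(* Let $n\ge 3$, let $p\in(1,\infty]$ and let $q\in[1,\infty)$ be the conjugate exponent of $p$, i.e. $\frac1p+\frac1q=1$ (with $q=1$ and $\frac{n-1}{p}=0$ if $p=\infty$). If $\phi\in L^{p}(\mathbb{S}^{n-1},\mathbb{R}^{n})$ and $u=P_{h}[\phi]$, then for every $x\in\mathbb{B}^{n}$, $$ |u(x)|\leq \frac{\mathbf{C}_{q}(x)^{1/q}}{(1-|x|^2)^{\frac{n-1}{p}}}\,\|\phi\|_{L^{p}}, $$ where $$ \mathbf{C}_{q}(x)={}_{2}F_{1}\left(-(n-1)(q-1),\ \tfrac{n}{2}+q-nq;\ \tfrac{n}{2};\ |x|^{2}\right). $$ Moreover, the inequality is sharp: for each $x\in\mathbb{B}^{n}$, the number $\mathbf{C}_{q}(x)^{1/q}(1-|x|^2)^{-\frac{n-1}{p}}$ is the smallest constant $K$ such that $|P_h[\phi](x)|\le K\|\phi\|_{L^p}$ for all $\phi\in L^{p}(\mathbb{S}^{n-1},\mathbb{R}^{n})$.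
   Context: $\mathbb{B}^{n}=\{x\in\mathbb{R}^{n}:|x|<1\}$ and $\mathbb{S}^{n-1}=\{x\in\mathbb{R}^{n}:|x|=1\}$, with $|\cdot|$ the Euclidean norm. $\sigma$ is the surface measure on $\mathbb{S}^{n-1}$ normalized so that $\sigma(\mathbb{S}^{n-1})=1$. $L^p(\mathbb{S}^{n-1},\mathbb{R}^n)$ is taken with respect to $\sigma$, with $\|\phi\|_{L^p}=\left(\int_{\mathbb{S}^{n-1}}|\phi|^p\,d\sigma\right)^{1/p}$ for $p<\infty$ and $\|\phi\|_{L^\infty}=\operatorname{ess\,sup}|\phi|$. For $\phi\in L^{1}(\mathbb{S}^{n-1},\mathbb{R}^{n})$, the invariant Poisson (Poisson-Szegö) integral of $\phi$ is $$P_{h}[\phi](x)=\int_{\mathbb{S}^{n-1}}P_{h}(x,\zeta)\phi(\zeta)\,d\sigma(\zeta),\quad x\in\mathbb{B}^n,\qquad P_{h}(x,\zeta)=\left(\frac{1-|x|^2}{|x-\zeta|^{2}}\right)^{n-1}.$$ The Gauss hypergeometric series is ${}_{2}F_{1}(a,b;c;t)=\sum_{k=0}^{\infty}\frac{(a)_{k}(b)_{k}}{k!\,(c)_{k}}t^{k}$, where $(a)_{0}=1$, $(a)_{k}=a(a+1)\cdots(a+k-1)$, and $c$ is neither zero nor a negative integer. *)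

theory Defs
  imports "HOL-Probability.Probability" "HOL-Probability.Essential_Supremum"
begin

section \<open>Surface measure on the unit sphere\<close>

text \<open>
  The library has no surface measure. The surface measure of a Borel set \<open>A\<close> in the unit sphere
  of \<open>\<real>\<^sup>n\<close> is taken to be \<open>n\<close> times the Lebesgue measure of the cone
  \<open>{r \<zeta> | 0 < r < 1, \<zeta> \<in> A}\<close>; this is the usual measure-theoretic definition, by integration in
  polar coordinates. The cone is the preimage of \<open>A\<close> in the punctured ball under
  \<open>sgn x = x / norm x\<close>.
\<close>

definition surface_measure :: "(real ^ 'n) measure" where
  "surface_measure =
     scale_measure (of_nat CARD('n))
       (distr (restrict_space lborel (ball 0 1 - {0})) (restrict_space borel (sphere 0 1)) sgn)"

definition sphere_measure :: "(real ^ 'n) measure" where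
  "sphere_measure = uniform_measure surface_measure (sphere 0 1)"

lemma space_surface_measure [simp]: "space surface_measure = sphere 0 1"
  by (simp add: surface_measure_def space_scale_measure space_restrict_space)

lemma sets_surface_measure [measurable_cong]:
  "sets surface_measure = sets (restrict_space borel (sphere 0 1))"
  by (simp add: surface_measure_def)

lemma space_sphere_measure [simp]: "space sphere_measure = sphere 0 1"
  by (simp add: sphere_measure_def)

lemma sets_sphere_measure [measurable_cong]:
  "sets sphere_measure = sets (restrict_space borel (sphere 0 1))"
  by (simp add: sphere_measure_def sets_surface_measure)

lemma measurable_sgn_punctured_ball:
  "sgn \<in> restrict_space lborel (ball 0 1 - {0}) \<rightarrow>\<^sub>M
     restrict_space borel (sphere 0 (1::real) :: (real ^ 'n) set)"
proof (rule measurable_restrict_space2)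
  show "sgn \<in> space (restrict_space lborel (ball 0 1 - {0})) \<rightarrow> (sphere 0 1 :: (real ^ 'n) set)"
    by (auto simp: space_restrict_space norm_sgn)
  have "(\<lambda>x::real ^ 'n. x /\<^sub>R norm x) \<in> borel_measurable borel"
    by measurable
  then have "(sgn :: real ^ 'n \<Rightarrow> real ^ 'n) \<in> borel_measurable lborel"
    by (simp add: sgn_div_norm[abs_def])
  then show "(sgn :: real ^ 'n \<Rightarrow> real ^ 'n) \<in> borel_measurable (restrict_space lborel (ball 0 1 - {0}))"
    by (rule measurable_restrict_space1)
qed

lemma emeasure_surface_measure:
  fixes A :: "(real ^ 'n) set"
  assumes "A \<in> sets borel" "A \<subseteq> sphere 0 1"
  shows "emeasure surface_measure A =
    of_nat CARD('n) * emeasure lborel {r *\<^sub>R \<zeta> | r \<zeta>. 0 < r \<and> r < 1 \<and> \<zeta> \<in> A}"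
proof -
  have A: "A \<in> sets (restrict_space borel (sphere 0 1))"
    using assms by (auto simp: sets_restrict_space)
  have eq: "sgn -` A \<inter> (ball 0 1 - {0}) = {r *\<^sub>R \<zeta> | r \<zeta>. 0 < r \<and> r < 1 \<and> \<zeta> \<in> A}" (is "?L = ?R")
  proof
    show "?L \<subseteq> ?R"
    proof
      fix x assume x: "x \<in> ?L"
      then have "x = norm x *\<^sub>R sgn x" by (simp add: sgn_div_norm)
      with x show "x \<in> ?R" by (intro CollectI exI[of _ "norm x"] exI[of _ "sgn x"]) auto
    qed
    show "?R \<subseteq> ?L"
    proof
      fix x assume "x \<in> ?R"
      then obtain r z where x: "x = r *\<^sub>R z" "0 < r" "r < 1" "z \<in> A" by blast
      moreover have "norm z = 1" using assms x by auto
      ultimately show "x \<in> ?L" by (auto simp: sgn_div_norm)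
    qed
  qed
  show ?thesis
    by (simp add: surface_measure_def emeasure_distr[OF measurable_sgn_punctured_ball A]
        space_restrict_space emeasure_restrict_space eq[symmetric])
qed

lemma emeasure_surface_measure_sphere:
  "emeasure surface_measure (sphere 0 1 :: (real ^ 'n) set) =
     ennreal (real CARD('n) * unit_ball_vol (real CARD('n)))"
proof -
  have S: "(sphere 0 1 :: (real ^ 'n) set) \<in> sets (restrict_space borel (sphere 0 1))"
    by (auto simp: sets_restrict_space)
  have "sgn -` sphere 0 1 \<inter> (ball 0 1 - {0}) = (ball 0 1 - {0} :: (real ^ 'n) set)"
    by (auto simp: norm_sgn)
  moreover have "emeasure lborel (ball 0 1 - {0} :: (real ^ 'n) set) = emeasure lborel (ball 0 1 :: (real ^ 'n) set)"
    by (rule emeasure_Diff_null_set) auto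
  ultimately show ?thesis
    by (simp add: surface_measure_def emeasure_distr[OF measurable_sgn_punctured_ball S]
        space_restrict_space emeasure_restrict_space emeasure_ball ennreal_mult ennreal_of_nat_eq_real_of_nat)
qed

lemma prob_space_sphere_measure: "prob_space (sphere_measure :: (real ^ 'n) measure)"
proof (rule prob_spaceI)
  have S: "(sphere 0 1 :: (real ^ 'n) set) \<in> sets surface_measure"
    by (auto simp: sets_surface_measure sets_restrict_space)
  have "unit_ball_vol (real CARD('n)) > 0"
    by simp
  then show "emeasure sphere_measure (space sphere_measure :: (real ^ 'n) set) = 1"
    unfolding space_sphere_measure
    by (simp add: sphere_measure_def emeasure_uniform_measure[OF S S] less_imp_neq[symmetric]
        emeasure_surface_measure_sphere divide_ennreal)
qed

section \<open>Lebesgue spaces on the sphere\<close>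

text \<open>
  Elements of \<open>L\<^sup>p\<close> are represented by Borel functions on the sphere. The exponent ranges over
  \<open>[0, \<infinity>]\<close>, with \<open>p = \<infinity>\<close> giving \<open>L\<^sup>\<infinity>\<close>.
\<close>

definition Lp_sphere :: "ennreal \<Rightarrow> (real ^ 'n \<Rightarrow> real ^ 'n) set" where
  "Lp_sphere p = {\<phi> \<in> borel_measurable sphere_measure.
     if p = \<infinity> then esssup sphere_measure (\<lambda>\<zeta>. ennreal (norm (\<phi> \<zeta>))) < \<infinity>
     else integrable sphere_measure (\<lambda>\<zeta>. norm (\<phi> \<zeta>) powr enn2real p)}"

definition Lp_norm :: "ennreal \<Rightarrow> (real ^ 'n \<Rightarrow> real ^ 'n) \<Rightarrow> real" where
  "Lp_norm p \<phi> =
    (if p = \<infinity> then enn2real (esssup sphere_measure (\<lambda>\<zeta>. ennreal (norm (\<phi> \<zeta>))))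
     else (\<integral>\<zeta>. norm (\<phi> \<zeta>) powr enn2real p \<partial>sphere_measure) powr (1 / enn2real p))"

section \<open>Invariant Poisson integral and the hypergeometric series\<close>

definition inv_poisson_kernel :: "real ^ 'n \<Rightarrow> real ^ 'n \<Rightarrow> real" where
  "inv_poisson_kernel x \<zeta> = ((1 - (norm x)\<^sup>2) / (norm (x - \<zeta>))\<^sup>2) ^ (CARD('n) - 1)"

definition inv_poisson_integral :: "(real ^ 'n \<Rightarrow> real ^ 'n) \<Rightarrow> real ^ 'n \<Rightarrow> real ^ 'n" where
  "inv_poisson_integral \<phi> x = (\<integral>\<zeta>. inv_poisson_kernel x \<zeta> *\<^sub>R \<phi> \<zeta> \<partial>sphere_measure)"

definition hypergeometric_2F1 :: "real \<Rightarrow> real \<Rightarrow> real \<Rightarrow> real \<Rightarrow> real" where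
  "hypergeometric_2F1 a b c t =
    (\<Sum>k. pochhammer a k * pochhammer b k / (fact k * pochhammer c k) * t ^ k)"

definition C_const :: "real \<Rightarrow> real ^ 'n \<Rightarrow> real" where
  "C_const q x = (let n = real CARD('n) in
     hypergeometric_2F1 (- (n - 1) * (q - 1)) (n / 2 + q - n * q) (n / 2) ((norm x)\<^sup>2))"

text \<open>
  The exponent \<open>(n - 1) / p\<close> is formed in \<open>[0, \<infinity>]\<close>, where division by \<open>\<infinity>\<close> gives \<open>0\<close>.
\<close>

definition sharp_const :: "ennreal \<Rightarrow> real \<Rightarrow> real ^ 'n \<Rightarrow> real" where
  "sharp_const p q x =
     C_const q x powr (1 / q) / (1 - (norm x)\<^sup>2) powr enn2real (of_nat (CARD('n) - 1) / p)"

end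

theory Submission
  imports Defs "HOL-Real_Asymp.Real_Asymp"
begin

text \<open>
  Hoelder's inequality, with the extremal functions \<open>P\<^sub>h(x, \<cdot>)\<^sup>q\<^sup>-\<^sup>1 e\<close> for a fixed unit vector \<open>e\<close>,
  shows that the best constant at \<open>x\<close> is the \<open>L\<^sup>q\<close> norm of the kernel \<open>P\<^sub>h(x, \<cdot>)\<close>. So with
  \<open>r = |x|\<close> and \<open>s = (n - 1) q\<close> one has to evaluate the spherical mean \<open>A\<^sub>s(r)\<close> of
  \<open>|x - \<zeta>|\<^sup>-\<^sup>2\<^sup>s\<close>, which by rotation invariance is the mean of \<open>(1 + r\<^sup>2 - 2 r t)\<^sup>-\<^sup>s\<close> in a single
  coordinate \<open>t\<close> of \<open>\<zeta>\<close>.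

  Differentiating the integral over the sphere along plane rotations gives an integration by parts
  formula for functions of \<open>t\<close>, and hence a three-term recurrence for \<open>A\<^sub>s\<^sub>-\<^sub>1, A\<^sub>s, A\<^sub>s\<^sub>+\<^sub>1\<close>. Together with
  \<open>r A\<^sub>s' = s (1 - r\<^sup>2) A\<^sub>s\<^sub>+\<^sub>1 - s A\<^sub>s\<close> this is a linear system for \<open>(A\<^sub>s, A\<^sub>s\<^sub>+\<^sub>1)\<close>, equivalent to the
  hypergeometric equation in \<open>r\<^sup>2\<close>, which is singular at \<open>0\<close>. A Wronskian argument shows that its solution
  regular at \<open>0\<close> is unique, so that \<open>(1 - r\<^sup>2)\<^sup>2\<^sup>s\<^sup>-\<^sup>n\<^sup>+\<^sup>1 A\<^sub>s(r)\<close> is the hypergeometric series.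
  Neither the Euler transformation nor analytic continuation is needed.
\<close>

section \<open>Rotation invariance\<close>

text \<open>
  The library proves the invariance of Lebesgue measure under orthogonal maps only for index types of
  class \<open>wellorder\<close>. A copy of the index type, well-ordered through an arbitrary enumeration, transfers
  it to all finite index types.
\<close>

typedef 'a idx = "UNIV :: 'a set" by simp

instance idx :: (finite) finite
proof
  have "UNIV = range (Abs_idx :: 'a \<Rightarrow> 'a idx)"
    by (metis Rep_idx_inverse surjI)
  then show "finite (UNIV :: 'a idx set)"
    by (metis finite finite_imageI)
qed

instantiation idx :: (finite) wellorder
begin

definition idx_rank :: "'a idx \<Rightarrow> nat" where
  "idx_rank = (SOME f. inj f)"

definition "x \<le> y \<longleftrightarrow> idx_rank x \<le> idx_rank y"
definition "x < y \<longleftrightarrow> idx_rank x < idx_rank y"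

lemma inj_idx_rank: "inj (idx_rank :: 'a idx \<Rightarrow> nat)"
proof -
  have "\<exists>f :: 'a idx \<Rightarrow> nat. inj f"
    using finite_imp_inj_to_nat_seg[of "UNIV :: 'a idx set"] by auto
  then show ?thesis
    unfolding idx_rank_def by (rule someI_ex)
qed

instance
proof
  fix P :: "'a idx \<Rightarrow> bool" and a
  assume *: "\<And>x. (\<And>y. y < x \<Longrightarrow> P y) \<Longrightarrow> P x"
  show "P a"
    by (induction a rule: measure_induct_rule[where f = idx_rank]) (auto intro: * simp: less_idx_def)
qed (auto simp: less_eq_idx_def less_idx_def dest: injD[OF inj_idx_rank])

end

section \<open>Relabelling of coordinates\<close>

definition reindex :: "(real, 'n::finite) vec \<Rightarrow> (real, 'n idx) vec" where
  "reindex x = (\<chi> i. x $ Rep_idx i)"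

definition unreindex :: "(real, 'n::finite idx) vec \<Rightarrow> (real, 'n) vec" where
  "unreindex x = (\<chi> i. x $ Abs_idx i)"

lemma unreindex_reindex [simp]: "unreindex (reindex x) = x"
  by (simp add: unreindex_def reindex_def vec_eq_iff Abs_idx_inverse)

lemma reindex_unreindex [simp]: "reindex (unreindex x) = x"
  by (simp add: unreindex_def reindex_def vec_eq_iff Rep_idx_inverse)

lemma linear_reindex: "linear (reindex :: (real, 'n::finite) vec \<Rightarrow> _)"
  by (rule linearI) (simp_all add: reindex_def vec_eq_iff)

lemma linear_unreindex: "linear (unreindex :: (real, 'n::finite idx) vec \<Rightarrow> _)"
  by (rule linearI) (simp_all add: unreindex_def vec_eq_iff)

lemma bij_Abs_idx: "bij Abs_idx"
  by (metis Abs_idx_inverse Rep_idx_inverse UNIV_I bijI')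

lemma inner_unreindex: "unreindex x \<bullet> unreindex y = x \<bullet> (y :: (real, 'n::finite idx) vec)"
  unfolding inner_vec_def unreindex_def
  by (simp add: sum.reindex_bij_betw[OF bij_Abs_idx, of "\<lambda>i. x $ i * y $ i"])

lemma borel_measurable_unreindex [measurable]:
  "(unreindex :: (real, 'n::finite idx) vec \<Rightarrow> _) \<in> borel_measurable borel"
  by (intro borel_measurable_continuous_onI linear_continuous_on linear_conv_bounded_linear[THEN iffD1] linear_unreindex)

lemma prod_Basis_cart:
  "(\<Prod>b\<in>Basis. f (x \<bullet> b)) = (\<Prod>i\<in>UNIV. f ((x :: real ^ 'n) $ i))"
proof -
  have B: "(Basis :: (real ^ 'n) set) = (\<lambda>i. axis i 1) ` UNIV"
    by (auto simp: Basis_vec_def)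
  show ?thesis
    unfolding B by (subst prod.reindex) (auto simp: inner_axis inj_on_def axis_eq_axis)
qed

text \<open>Boxes determine Lebesgue measure, and a relabelling of the coordinates takes boxes to
  boxes with the same side lengths.\<close>

lemma distr_lborel_unreindex:
  "distr lborel borel unreindex = (lborel :: ((real, 'n::finite) vec) measure)"
proof (rule lborel_eqI[symmetric])
  fix l u :: "real ^ 'n"
  assume le: "\<And>b. b \<in> Basis \<Longrightarrow> l \<bullet> b \<le> u \<bullet> b"
  have pre: "unreindex -` box l u = box (reindex l) (reindex u)"
    apply (auto simp: mem_box_cart reindex_def unreindex_def)
    apply (metis Rep_idx_inverse)+
    apply (metis Abs_idx_inverse UNIV_I)+
    done
  have le': "(reindex l) \<bullet> b \<le> (reindex u) \<bullet> b" if "b \<in> Basis" for b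
  proof -
    from that obtain i where b: "b = axis i 1"
      by (auto simp: Basis_vec_def)
    then show ?thesis
      using le[of "axis (Rep_idx i) 1"] by (simp add: inner_axis reindex_def)
  qed
  have "emeasure (distr lborel borel unreindex) (box l u) = ennreal (\<Prod>b\<in>Basis. (reindex u - reindex l) \<bullet> b)"
    using le' by (auto simp: emeasure_distr pre emeasure_lborel_box_eq)
  also have "(\<Prod>b\<in>Basis. (reindex u - reindex l) \<bullet> b) = (\<Prod>i\<in>UNIV. (unreindex (reindex u - reindex l)) $ i)"
    unfolding prod_Basis_cart[of "\<lambda>x. x"] unreindex_def
    by (simp add: prod.reindex_bij_betw[OF bij_Abs_idx, of "\<lambda>i. reindex u $ i - reindex l $ i"])
  also have "\<dots> = (\<Prod>b\<in>Basis. (u - l) \<bullet> b)"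
    unfolding prod_Basis_cart[of "\<lambda>x. x"] by (simp add: linear_diff[OF linear_unreindex])
  finally show "emeasure (distr lborel borel unreindex) (box l u) = (\<Prod>b\<in>Basis. (u - l) \<bullet> b)" .
qed simp

section \<open>Lebesgue measure under orthogonal maps\<close>

lemma borel_measurable_orthogonal_transformation:
  "orthogonal_transformation f \<Longrightarrow> f \<in> borel_measurable borel" for f :: "real ^ 'n \<Rightarrow> real ^ 'n"
  by (intro borel_measurable_continuous_onI linear_continuous_on linear_conv_bounded_linear[THEN iffD1]
      orthogonal_transformation_linear)

text \<open>It suffices to test boxes. \<open>measure_orthogonal_image\<close> concerns images, so
  the preimage of a box is treated as its image under the inverse map, which is again
  orthogonal.\<close>

lemma distr_lborel_orthogonal_wellorder:
  fixes f :: "(real, 'n::{finite,wellorder}) vec \<Rightarrow> (real, 'n) vec"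
  assumes "orthogonal_transformation f"
  shows "distr lborel borel f = lborel"
proof (rule lborel_eqI[symmetric])
  note [measurable] = borel_measurable_orthogonal_transformation[OF assms]
  fix l u :: "(real, 'n) vec"
  assume le: "\<And>b. b \<in> Basis \<Longrightarrow> l \<bullet> b \<le> u \<bullet> b"
  have bij: "bij f" by (rule orthogonal_transformation_bij[OF assms])
  have pre: "f -` box l u = inv f ` box l u"
    using bij by (simp add: bij_vimage_eq_inv_image)
  have o: "orthogonal_transformation (inv f)"
    by (rule orthogonal_transformation_inv[OF assms])
  have "f -` box l u \<in> sets borel"
    using measurable_sets[of f borel borel "box l u"] by simp
  then have B: "inv f ` box l u \<in> sets borel" by (simp add: pre)
  have L: "inv f ` box l u \<in> lmeasurable"
    by (rule measurable_orthogonal_image[OF o]) simp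
  have "emeasure lborel (inv f ` box l u) = emeasure lebesgue (inv f ` box l u)"
    using B by simp
  also have "\<dots> = measure lebesgue (inv f ` box l u)"
    using L by (rule emeasure_eq_measure2)
  also have "\<dots> = measure lebesgue (box l u)"
    by (subst measure_orthogonal_image[OF o]) auto
  also have "\<dots> = emeasure lborel (box l u)"
    by (subst emeasure_eq_measure2[symmetric]) auto
  finally have "emeasure lborel (inv f ` box l u) = emeasure lborel (box l u)" .
  then show "emeasure (distr lborel borel f) (box l u) = (\<Prod>b\<in>Basis. (u - l) \<bullet> b)"
    using le by (simp add: emeasure_distr pre emeasure_lborel_box_eq)
qed simp

text \<open>Conjugation by \<open>reindex\<close> carries \<open>f\<close> to an orthogonal map
  \<open>g\<close> over the well-ordered copy, and
  \<open>f \<circ> unreindex = unreindex \<circ> g\<close> brings the invariance back.\<close>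

lemma distr_lborel_orthogonal:
  fixes f :: "real ^ 'n \<Rightarrow> real ^ 'n"
  assumes f: "orthogonal_transformation f"
  shows "distr lborel borel f = lborel"
proof -
  note [measurable] = borel_measurable_orthogonal_transformation[OF f]
  define g where "g = (\<lambda>x. reindex (f (unreindex x)))"
  have g: "orthogonal_transformation g"
    unfolding orthogonal_transformation_def
  proof (intro conjI allI)
    show "linear g"
      unfolding g_def
      using linear_compose[OF linear_compose[OF linear_unreindex orthogonal_transformation_linear[OF f]] linear_reindex]
      by (simp add: o_def)
    show "g x \<bullet> g y = x \<bullet> y" for x y
      using f unfolding g_def orthogonal_transformation_def
      by (subst inner_unreindex[symmetric]) (simp add: inner_unreindex)
  qed
  note [measurable] = borel_measurable_orthogonal_transformation[OF g]
  have "distr lborel borel f = distr (distr lborel borel unreindex) borel f"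
    by (simp add: distr_lborel_unreindex)
  also have "\<dots> = distr lborel borel (f \<circ> unreindex)"
    by (subst distr_distr) auto
  also have "f \<circ> unreindex = unreindex \<circ> g"
    by (auto simp: g_def)
  also have "distr lborel borel (unreindex \<circ> g) = distr (distr lborel borel g) borel unreindex"
    by (subst distr_distr) auto
  also have "\<dots> = lborel"
    by (simp add: distr_lborel_orthogonal_wellorder[OF g] distr_lborel_unreindex)
  finally show ?thesis .
qed

section \<open>Invariance of the measure on the sphere\<close>

lemma borel_measurable_component [measurable]:
  "(\<lambda>x::real ^ 'n. x $ i) \<in> borel_measurable borel"
  by (intro borel_measurable_continuous_onI continuous_intros)

lemma borel_measurable_sphere_measure:
  "g \<in> borel_measurable borel \<Longrightarrow> g \<in> borel_measurable (sphere_measure :: (real ^ 'n) measure)"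
  unfolding measurable_cong_sets[OF sets_sphere_measure refl] by (rule measurable_restrict_space1)

text \<open>An orthogonal map preserves norms and commutes with normalization, so the cone over the
  preimage of \<open>A\<close> is the preimage of the cone over \<open>A\<close>. Invariance of
  Lebesgue measure then passes to the sphere.\<close>

lemma sphere_measure_orthogonal:
  fixes f :: "real ^ 'n \<Rightarrow> real ^ 'n"
  assumes f: "orthogonal_transformation f"
  shows "distr sphere_measure sphere_measure f = sphere_measure"
proof (rule measure_eqI)
  note [measurable] = borel_measurable_orthogonal_transformation[OF f]
  have f_sphere: "f x \<in> sphere 0 1 \<longleftrightarrow> x \<in> sphere 0 1" for x
    using f by (simp add: orthogonal_transformation_norm)
  have fm: "f \<in> sphere_measure \<rightarrow>\<^sub>M sphere_measure"
    unfolding measurable_cong_sets[OF sets_sphere_measure sets_sphere_measure]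
    by (rule measurable_restrict_space3) (use f_sphere in auto)
  fix A assume "A \<in> sets (distr sphere_measure sphere_measure f)"
  then have A: "A \<in> sets (sphere_measure :: (real ^ 'n) measure)" by simp
  then have A': "A \<in> sets borel" "A \<subseteq> sphere 0 1"
    by (auto simp: sets_sphere_measure sets_restrict_space)
  define B where "B = f -` A \<inter> sphere 0 1"
  have "B \<in> sets (sphere_measure :: (real ^ 'n) measure)"
    using measurable_sets[OF fm A] by (simp add: B_def)
  then have B: "B \<in> sets borel" "B \<subseteq> sphere 0 1"
    by (auto simp: sets_sphere_measure sets_restrict_space)
  \<comment> \<open>As an intersection with a preimage, the cone is visibly Borel when
    \<open>A\<close> is, and its preimage under \<open>f\<close> can be computed pointwise.\<close>
  have cone: "{r *\<^sub>R \<zeta> | r \<zeta>. 0 < r \<and> r < 1 \<and> \<zeta> \<in> A} = (ball 0 1 - {0}) \<inter> (\<lambda>x. x /\<^sub>R norm x) -` A"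
    if "A \<subseteq> sphere 0 1" for A :: "(real ^ 'n) set"
  proof (intro equalityI subsetI)
    fix x assume "x \<in> (ball 0 1 - {0}) \<inter> (\<lambda>x. x /\<^sub>R norm x) -` A"
    then show "x \<in> {r *\<^sub>R \<zeta> | r \<zeta>. 0 < r \<and> r < 1 \<and> \<zeta> \<in> A}"
      by (intro CollectI exI[of _ "norm x"] exI[of _ "x /\<^sub>R norm x"]) auto
  qed (use that in auto)
  have "emeasure lborel ((ball 0 1 - {0}) \<inter> (\<lambda>x. x /\<^sub>R norm x) -` A)
    = emeasure (distr lborel borel f) ((ball 0 1 - {0}) \<inter> (\<lambda>x. x /\<^sub>R norm x) -` A)"
    by (simp add: distr_lborel_orthogonal[OF f])
  also have "\<dots> = emeasure lborel (f -` ((ball 0 1 - {0}) \<inter> (\<lambda>x. x /\<^sub>R norm x) -` A))"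
  proof (subst emeasure_distr)
    have "(\<lambda>x::real ^ 'n. x /\<^sub>R norm x) -` A \<inter> space borel \<in> sets borel"
      using A'(1) by (rule measurable_sets[rotated]) measurable
    then show "(ball 0 1 - {0}) \<inter> (\<lambda>x. x /\<^sub>R norm x) -` A \<in> sets borel"
      by auto
  qed auto
  also have "f -` ((ball 0 1 - {0}) \<inter> (\<lambda>x. x /\<^sub>R norm x) -` A) = (ball 0 1 - {0}) \<inter> (\<lambda>x. x /\<^sub>R norm x) -` B"
  proof -
    have *: "f (x /\<^sub>R norm x) = f x /\<^sub>R norm (f x)" "norm (f x) = norm x" for x
      using f by (simp_all add: orthogonal_transformation_norm orthogonal_transformation_linear linear_scale)
    then have **: "f x = 0 \<longleftrightarrow> x = 0" for x
      by (metis norm_eq_zero)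
    \<comment> \<open>This settles the condition \<open>sphere 0 1\<close> in the definition of
      \<open>B\<close>.\<close>
    have "norm (x /\<^sub>R norm x) = 1" if "x \<noteq> 0" for x :: "real ^ 'n"
      using that by simp
    then have "f x \<in> (ball 0 1 - {0}) \<inter> (\<lambda>x. x /\<^sub>R norm x) -` A \<longleftrightarrow> x \<in> (ball 0 1 - {0}) \<inter> (\<lambda>x. x /\<^sub>R norm x) -` B" for x
      unfolding B_def Int_iff Diff_iff mem_ball_0 vimage_eq singleton_iff mem_sphere_0 *(1) *(2) ** by metis
    then show ?thesis
      by blast
  qed
  finally have "emeasure surface_measure A = emeasure surface_measure B"
    unfolding emeasure_surface_measure[OF A'] emeasure_surface_measure[OF B] cone[OF A'(2)] cone[OF B(2)]
    by simp
  moreover have "sphere 0 1 \<inter> A = A" "sphere 0 1 \<inter> B = B"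
    using A' B by auto
  moreover have "A \<in> sets surface_measure" "B \<in> sets surface_measure"
      "(sphere 0 1 :: (real ^ 'n) set) \<in> sets surface_measure"
    using A' B by (auto simp: sets_surface_measure sets_restrict_space)
  ultimately have "emeasure sphere_measure B = emeasure sphere_measure A"
    by (simp add: sphere_measure_def emeasure_uniform_measure)
  then show "emeasure (distr sphere_measure sphere_measure f) A = emeasure sphere_measure A"
    by (simp add: emeasure_distr[OF fm A] B_def)
qed simp

lemma integral_sphere_measure_orthogonal:
  fixes f :: "real ^ 'n \<Rightarrow> real ^ 'n" and g :: "real ^ 'n \<Rightarrow> real"
  assumes f: "orthogonal_transformation f" and g: "g \<in> borel_measurable borel"
  shows "(\<integral>\<zeta>. g (f \<zeta>) \<partial>sphere_measure) = (\<integral>\<zeta>. g \<zeta> \<partial>sphere_measure)"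
proof -
  have fm: "f \<in> sphere_measure \<rightarrow>\<^sub>M sphere_measure"
    unfolding measurable_cong_sets[OF sets_sphere_measure sets_sphere_measure]
    by (rule measurable_restrict_space3[OF borel_measurable_orthogonal_transformation[OF f]])
      (use f in \<open>auto simp: orthogonal_transformation_norm\<close>)
  show ?thesis
    using integral_distr[OF fm borel_measurable_sphere_measure[OF g]]
    by (simp add: sphere_measure_orthogonal[OF f])
qed

section \<open>Integration by parts on the sphere\<close>

text \<open>By the mean value inequality the difference quotients are bounded by \<open>C\<close>,
  and constants are integrable for a finite measure; dominated convergence applies along every
  sequence tending to \<open>x\<close>.\<close>

lemma (in finite_measure) has_real_derivative_integral:
  fixes f f' :: "real \<Rightarrow> 'a \<Rightarrow> real"
  assumes S: "open S" "convex S" "x \<in> S"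
    and int: "\<And>y. y \<in> S \<Longrightarrow> integrable M (f y)"
    and deriv: "\<And>y z. y \<in> S \<Longrightarrow> z \<in> space M \<Longrightarrow> ((\<lambda>y. f y z) has_real_derivative f' y z) (at y)"
    and bound: "\<And>y z. y \<in> S \<Longrightarrow> z \<in> space M \<Longrightarrow> \<bar>f' y z\<bar> \<le> C"
  shows "((\<lambda>y. \<integral>z. f y z \<partial>M) has_real_derivative (\<integral>z. f' x z \<partial>M)) (at x)"
proof -
  have "((\<lambda>y. \<integral>z. f y z \<partial>M) has_real_derivative (\<integral>z. f' x z \<partial>M)) (at x within S)"
    unfolding has_field_derivative_iff tendsto_at_iff_sequentially
  proof (intro allI impI)
    fix X :: "nat \<Rightarrow> real" assume X: "\<forall>i. X i \<in> S - {x}" and lim: "X \<longlonglongrightarrow> x"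
    have quot: "((\<integral>z. f (X i) z \<partial>M) - (\<integral>z. f x z \<partial>M)) / (X i - x) = (\<integral>z. (f (X i) z - f x z) / (X i - x) \<partial>M)" for i
      using X S by (simp add: int Bochner_Integration.integral_diff)
    have pt: "(\<lambda>i. (f (X i) z - f x z) / (X i - x)) \<longlonglongrightarrow> f' x z" if "z \<in> space M" for z
      using deriv[OF S(3) that, THEN has_field_derivative_at_within, of S] X lim
      unfolding has_field_derivative_iff tendsto_at_iff_sequentially by (auto simp: o_def)
    have "(\<lambda>i. \<integral>z. (f (X i) z - f x z) / (X i - x) \<partial>M) \<longlonglongrightarrow> (\<integral>z. f' x z \<partial>M)"
    proof (rule integral_dominated_convergence[where w = "\<lambda>_. C"])
      show "(\<lambda>z. (f (X i) z - f x z) / (X i - x)) \<in> borel_measurable M" for i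
        using X S int[THEN borel_measurable_integrable] by auto
      \<comment> \<open>The derivative inherits measurability as a pointwise limit of difference
        quotients.\<close>
      then show "f' x \<in> borel_measurable M"
        by (rule borel_measurable_LIMSEQ_metric[of "\<lambda>i z. (f (X i) z - f x z) / (X i - x)"]) (rule pt)
      show "AE z in M. norm ((f (X i) z - f x z) / (X i - x)) \<le> C" for i
      proof (rule AE_I2)
        fix z assume z: "z \<in> space M"
        have "norm (f (X i) z - f x z) \<le> C * norm (X i - x)"
          using S X z by (intro field_differentiable_bound[of S _ "\<lambda>y. f' y z"])
            (auto intro: has_field_derivative_at_within deriv bound)
        moreover have "X i \<noteq> x" using X by auto
        ultimately show "norm ((f (X i) z - f x z) / (X i - x)) \<le> C"
          by (simp add: divide_le_eq)
      qed
    qed (use pt in auto)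
    then show "((\<lambda>y. ((\<integral>z. f y z \<partial>M) - (\<integral>z. f x z \<partial>M)) / (y - x)) \<circ> X) \<longlonglongrightarrow> (\<integral>z. f' x z \<partial>M)"
      by (simp add: o_def quot)
  qed
  then show ?thesis
    by (simp only: at_within_open[OF S(3,1)])
qed

section \<open>Plane rotations and their infinitesimal action\<close>

definition plane_rotation :: "'n \<Rightarrow> 'n \<Rightarrow> real \<Rightarrow> real ^ 'n \<Rightarrow> real ^ 'n" where
  "plane_rotation k j \<theta> x = (\<chi> i. if i = k then cos \<theta> * x $ k - sin \<theta> * x $ j
     else if i = j then sin \<theta> * x $ k + cos \<theta> * x $ j else x $ i)"

lemma orthogonal_transformation_plane_rotation:
  assumes "k \<noteq> (j :: 'n::finite)"
  shows "orthogonal_transformation (plane_rotation k j \<theta>)"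
  unfolding orthogonal_transformation
proof (intro conjI allI)
  show "linear (plane_rotation k j \<theta>)"
    by (rule linearI) (auto simp: plane_rotation_def vec_eq_iff algebra_simps)
  fix x :: "real ^ 'n"
  have split: "sum g UNIV = g k + g j + sum g (UNIV - {k} - {j})" for g :: "'n \<Rightarrow> real"
    using assms by (subst sum.remove[of UNIV k], simp, simp, subst sum.remove[of "UNIV - {k}" j]) auto
  have "(cos \<theta> * x $ k - sin \<theta> * x $ j)\<^sup>2 + (sin \<theta> * x $ k + cos \<theta> * x $ j)\<^sup>2
      = (x $ k)\<^sup>2 * ((sin \<theta>)\<^sup>2 + (cos \<theta>)\<^sup>2) + (x $ j)\<^sup>2 * ((sin \<theta>)\<^sup>2 + (cos \<theta>)\<^sup>2)"
    by algebra
  then have "(\<Sum>i\<in>UNIV. (plane_rotation k j \<theta> x $ i)\<^sup>2) = (\<Sum>i\<in>UNIV. (x $ i)\<^sup>2)"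
    unfolding split using assms by (auto simp: plane_rotation_def intro!: sum.cong)
  then show "norm (plane_rotation k j \<theta> x) = norm x"
    by (simp add: norm_vec_def L2_set_def)
qed

lemma continuous_on_Icc_abs_bounded:
  fixes g :: "real \<Rightarrow> real"
  assumes "continuous_on {a..b} g"
  obtains C where "\<And>t. t \<in> {a..b} \<Longrightarrow> \<bar>g t\<bar> \<le> C"
proof -
  from assms have "bounded (g ` {a..b})"
    by (intro compact_imp_bounded compact_continuous_image) auto
  then show ?thesis
    using that unfolding bounded_iff by (metis image_eqI real_norm_def)
qed

lemma sphere_component_bounds:
  "\<zeta> \<in> sphere 0 1 \<Longrightarrow> \<zeta> $ k \<in> {-1..1}" for \<zeta> :: "real ^ 'n"
  using component_le_norm_cart[of \<zeta> k] by (auto simp: abs_le_iff)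

lemma integrable_sphere_measure_bounded:
  fixes g :: "real ^ 'n \<Rightarrow> real"
  assumes "g \<in> borel_measurable borel" "\<And>\<zeta>. \<zeta> \<in> sphere 0 1 \<Longrightarrow> \<bar>g \<zeta>\<bar> \<le> C"
  shows "integrable sphere_measure g"
proof -
  interpret prob_space "sphere_measure :: (real ^ 'n) measure"
    by (rule prob_space_sphere_measure)
  show ?thesis
    using assms by (intro integrable_const_bound[where B = C] borel_measurable_sphere_measure AE_I2) auto
qed

text \<open>By invariance, the integral of \<open>\<zeta> $ j * \<psi> (\<zeta> $ k)\<close> does
  not change when \<zeta> is rotated in the plane of \<open>k\<close> and \<open>j\<close>. The
  integrand here is the derivative in the angle at 0.\<close>

lemma integral_sphere_infinitesimal_rotation:
  fixes \<psi> \<psi>' :: "real \<Rightarrow> real" and k j :: "'n::finite"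
  assumes kj: "k \<noteq> j"
    and [measurable]: "\<psi> \<in> borel_measurable borel"
    and deriv: "\<And>t. t \<in> {-1..1} \<Longrightarrow> (\<psi> has_real_derivative \<psi>' t) (at t)"
    and cont: "continuous_on {-1..1} \<psi>'"
  shows "(\<integral>\<zeta>. \<zeta> $ k * \<psi> (\<zeta> $ k) - (\<zeta> $ j)\<^sup>2 * \<psi>' (\<zeta> $ k) \<partial>(sphere_measure :: (real ^ 'n) measure)) = 0"
proof -
  interpret prob_space "sphere_measure :: (real ^ 'n) measure"
    by (rule prob_space_sphere_measure)
  have cont\<psi>: "continuous_on {-1..1} \<psi>"
    by (rule DERIV_continuous_on) (blast intro: has_field_derivative_at_within deriv)
  obtain C where C: "\<And>t. t \<in> {-1..1} \<Longrightarrow> \<bar>\<psi> t\<bar> \<le> C"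
    using continuous_on_Icc_abs_bounded[OF cont\<psi>] by blast
  obtain C' where C': "\<And>t. t \<in> {-1..1} \<Longrightarrow> \<bar>\<psi>' t\<bar> \<le> C'"
    using continuous_on_Icc_abs_bounded[OF cont] by blast
  define g where "g x = x $ j * \<psi> (x $ k)" for x :: "real ^ 'n"
  have gm[measurable]: "g \<in> borel_measurable borel"
    unfolding g_def by measurable
  define R where "R = (plane_rotation k j :: real \<Rightarrow> real ^ 'n \<Rightarrow> _)"
  have o: "orthogonal_transformation (R \<theta>)" for \<theta>
    unfolding R_def using kj by (rule orthogonal_transformation_plane_rotation)
  have Rs: "R \<theta> \<zeta> \<in> sphere 0 1" if "\<zeta> \<in> sphere 0 1" for \<theta> \<zeta>
    using o that by (simp add: orthogonal_transformation_norm)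
  have Rk: "R \<theta> \<zeta> $ k = cos \<theta> * \<zeta> $ k - sin \<theta> * \<zeta> $ j"
    and Rj: "R \<theta> \<zeta> $ j = sin \<theta> * \<zeta> $ k + cos \<theta> * \<zeta> $ j" for \<theta> \<zeta>
    using kj by (auto simp: R_def plane_rotation_def)
  have gb: "\<bar>g \<zeta>\<bar> \<le> C" if "\<zeta> \<in> sphere 0 1" for \<zeta>
    using mult_mono[of "\<bar>\<zeta> $ j\<bar>" 1 "\<bar>\<psi> (\<zeta> $ k)\<bar>" C] C sphere_component_bounds[OF that]
    by (simp add: g_def abs_mult abs_le_iff)
  \<comment> \<open>Along the rotation the coordinate \<open>k\<close> has derivative minus the
    coordinate \<open>j\<close>, and \<open>j\<close> has derivative \<open>k\<close>. Written in
    rotated coordinates, the derivative has the same form at every angle, which makes the bound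
    \<open>C + C'\<close> uniform.\<close>
  define f' where "f' \<theta> \<zeta> = R \<theta> \<zeta> $ k * \<psi> (R \<theta> \<zeta> $ k) - (R \<theta> \<zeta> $ j)\<^sup>2 * \<psi>' (R \<theta> \<zeta> $ k)" for \<theta> \<zeta>
  have "((\<lambda>\<theta>. \<integral>\<zeta>. g (R \<theta> \<zeta>) \<partial>sphere_measure) has_real_derivative (\<integral>\<zeta>. f' 0 \<zeta> \<partial>sphere_measure)) (at 0)"
  proof (rule has_real_derivative_integral[where S = UNIV and C = "C + C'"])
    show "integrable sphere_measure (\<lambda>\<zeta>. g (R \<theta> \<zeta>))" for \<theta>
      by (rule integrable_sphere_measure_bounded[where C = C])
        (use gb Rs borel_measurable_orthogonal_transformation[OF o[of \<theta>]] in auto)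
    fix \<theta> :: real and \<zeta> :: "real ^ 'n" assume "\<zeta> \<in> space sphere_measure"
    then have \<zeta>: "R \<theta> \<zeta> $ i \<in> {-1..1}" for i
      using Rs sphere_component_bounds by (metis space_sphere_measure)
    have "((\<lambda>\<theta>. \<psi> (R \<theta> \<zeta> $ k)) has_real_derivative \<psi>' (R \<theta> \<zeta> $ k) * (- R \<theta> \<zeta> $ j)) (at \<theta>)"
      by (rule DERIV_chain2[where f = \<psi> and g = "\<lambda>\<theta>. R \<theta> \<zeta> $ k", OF deriv[OF \<zeta>]]) (auto intro!: derivative_eq_intros simp: Rk Rj)
    moreover have "((\<lambda>\<theta>. R \<theta> \<zeta> $ j) has_real_derivative R \<theta> \<zeta> $ k) (at \<theta>)"
      by (auto intro!: derivative_eq_intros simp: Rk Rj)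
    ultimately show "((\<lambda>\<theta>. g (R \<theta> \<zeta>)) has_real_derivative f' \<theta> \<zeta>) (at \<theta>)"
      unfolding g_def f'_def by (auto intro!: derivative_eq_intros simp: power2_eq_square algebra_simps)
    have "\<bar>R \<theta> \<zeta> $ k * \<psi> (R \<theta> \<zeta> $ k)\<bar> \<le> 1 * C"
      unfolding abs_mult by (rule mult_mono) (use \<zeta> C[OF \<zeta>] in \<open>auto simp: abs_le_iff\<close>)
    moreover have "\<bar>(R \<theta> \<zeta> $ j)\<^sup>2 * \<psi>' (R \<theta> \<zeta> $ k)\<bar> \<le> 1 * C'"
      unfolding abs_mult by (rule mult_mono) (use \<zeta>[of j] C'[OF \<zeta>] in \<open>auto simp: abs_square_le_1 abs_le_iff\<close>)
    ultimately show "\<bar>f' \<theta> \<zeta>\<bar> \<le> C + C'"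
      unfolding f'_def by linarith
  qed auto
  moreover have "(\<lambda>\<theta>. \<integral>\<zeta>. g (R \<theta> \<zeta>) \<partial>sphere_measure) = (\<lambda>\<theta>. \<integral>\<zeta>. g \<zeta> \<partial>sphere_measure)"
    by (intro ext integral_sphere_measure_orthogonal o gm)
  ultimately have "(\<integral>\<zeta>. f' 0 \<zeta> \<partial>sphere_measure) = 0"
    by (metis DERIV_const DERIV_unique)
  then show ?thesis
    by (simp add: f'_def Rk Rj)
qed

lemma sum_square_components_sphere:
  "\<zeta> \<in> sphere 0 1 \<Longrightarrow> (\<Sum>j\<in>UNIV - {k}. (\<zeta> $ j)\<^sup>2) = 1 - (\<zeta> $ k)\<^sup>2" for \<zeta> :: "real ^ 'n"
  using sum.remove[of UNIV k "\<lambda>j. (\<zeta> $ j)\<^sup>2"] by (simp add: norm_vec_def L2_set_def)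

text \<open>Sum the identity for infinitesimal rotations over all \<open>j \<noteq> k\<close>: the
  first term occurs n - 1 times, and the squares \<open>(\<zeta> $ j)\<^sup>2\<close> add up to
  \<open>1 - (\<zeta> $ k)\<^sup>2\<close>. The distribution of a single coordinate never has to be
  computed.\<close>

lemma integral_sphere_by_parts:
  fixes \<psi> \<psi>' :: "real \<Rightarrow> real" and k :: "'n::finite"
  assumes [measurable]: "\<psi> \<in> borel_measurable borel" "\<psi>' \<in> borel_measurable borel"
    and deriv: "\<And>t. t \<in> {-1..1} \<Longrightarrow> (\<psi> has_real_derivative \<psi>' t) (at t)"
    and cont: "continuous_on {-1..1} \<psi>'"
  shows "(real CARD('n) - 1) * (\<integral>\<zeta>. \<zeta> $ k * \<psi> (\<zeta> $ k) \<partial>(sphere_measure :: (real ^ 'n) measure))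
    = (\<integral>\<zeta>. (1 - (\<zeta> $ k)\<^sup>2) * \<psi>' (\<zeta> $ k) \<partial>(sphere_measure :: (real ^ 'n) measure))"
proof -
  let ?\<sigma> = "sphere_measure :: (real ^ 'n) measure"
  have cont\<psi>: "continuous_on {-1..1} \<psi>"
    by (rule DERIV_continuous_on) (blast intro: has_field_derivative_at_within deriv)
  obtain C where C: "\<And>t. t \<in> {-1..1} \<Longrightarrow> \<bar>\<psi> t\<bar> \<le> C"
    using continuous_on_Icc_abs_bounded[OF cont\<psi>] by blast
  obtain C' where C': "\<And>t. t \<in> {-1..1} \<Longrightarrow> \<bar>\<psi>' t\<bar> \<le> C'"
    using continuous_on_Icc_abs_bounded[OF cont] by blast
  have i1: "integrable ?\<sigma> (\<lambda>\<zeta>. \<zeta> $ k * \<psi> (\<zeta> $ k))"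
  proof (rule integrable_sphere_measure_bounded)
    fix \<zeta> :: "real ^ 'n" assume "\<zeta> \<in> sphere 0 1"
    note b = sphere_component_bounds[OF this]
    show "\<bar>\<zeta> $ k * \<psi> (\<zeta> $ k)\<bar> \<le> 1 * C"
      unfolding abs_mult by (rule mult_mono) (use b C[OF b] in \<open>auto simp: abs_le_iff\<close>)
  qed measurable
  have i2: "integrable ?\<sigma> (\<lambda>\<zeta>. (\<zeta> $ j)\<^sup>2 * \<psi>' (\<zeta> $ k))" for j
  proof (rule integrable_sphere_measure_bounded)
    fix \<zeta> :: "real ^ 'n" assume "\<zeta> \<in> sphere 0 1"
    note b = sphere_component_bounds[OF this]
    show "\<bar>(\<zeta> $ j)\<^sup>2 * \<psi>' (\<zeta> $ k)\<bar> \<le> 1 * C'"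
      unfolding abs_mult by (rule mult_mono) (use b[of j] C'[OF b] in \<open>auto simp: abs_square_le_1 abs_le_iff\<close>)
  qed measurable
  have "(real CARD('n) - 1) * (\<integral>\<zeta>. \<zeta> $ k * \<psi> (\<zeta> $ k) \<partial>?\<sigma>) = (\<Sum>j\<in>UNIV - {k}. \<integral>\<zeta>. \<zeta> $ k * \<psi> (\<zeta> $ k) \<partial>?\<sigma>)"
    by (simp add: card_Diff_singleton of_nat_diff)
  also have "\<dots> = (\<Sum>j\<in>UNIV - {k}. \<integral>\<zeta>. (\<zeta> $ j)\<^sup>2 * \<psi>' (\<zeta> $ k) \<partial>?\<sigma>)"
  proof (rule sum.cong)
    fix j assume "j \<in> UNIV - {k}"
    then show "(\<integral>\<zeta>. \<zeta> $ k * \<psi> (\<zeta> $ k) \<partial>?\<sigma>) = (\<integral>\<zeta>. (\<zeta> $ j)\<^sup>2 * \<psi>' (\<zeta> $ k) \<partial>?\<sigma>)"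
      using integral_sphere_infinitesimal_rotation[of k j, OF _ assms(1) deriv cont] i1 i2
      by (auto simp: Bochner_Integration.integral_diff)
  qed simp
  also have "\<dots> = (\<integral>\<zeta>. (\<Sum>j\<in>UNIV - {k}. (\<zeta> $ j)\<^sup>2 * \<psi>' (\<zeta> $ k)) \<partial>?\<sigma>)"
    by (simp add: Bochner_Integration.integral_sum i2)
  also have "\<dots> = (\<integral>\<zeta>. (1 - (\<zeta> $ k)\<^sup>2) * \<psi>' (\<zeta> $ k) \<partial>?\<sigma>)"
    by (rule Bochner_Integration.integral_cong) (simp_all add: sum_square_components_sphere flip: sum_distrib_right)
  finally show ?thesis .
qed

section \<open>Spherical means of powers of the distance\<close>

text \<open>A power is monotone in one direction or the other; adding both endpoint values covers
  either sign of the exponent.\<close>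

lemma powr_Icc_bound:
  fixes x lo hi a :: real
  assumes "0 < lo" "lo \<le> x" "x \<le> hi"
  shows "x powr a \<le> lo powr a + hi powr a"
proof (cases "0 \<le> a")
  case True
  then have "x powr a \<le> hi powr a" using assms by (intro powr_mono2) auto
  then show ?thesis by (simp add: add_increasing)
next
  case False
  then have "x powr a \<le> lo powr a" using assms by (intro powr_mono2') auto
  then show ?thesis by (simp add: add_increasing2)
qed

text \<open>The squared distance between \<zeta> and \<open>r\<close> times \<open>e\<close>, for
  unit vectors \<zeta> and \<open>e\<close> with inner product \<open>t\<close>.\<close>

definition sq_dist :: "real \<Rightarrow> real \<Rightarrow> real" where
  "sq_dist r t = 1 + r\<^sup>2 - 2 * r * t"

lemma abs_mult_le_abs:
  fixes r t :: real
  assumes "t \<in> {-1..1}"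
  shows "\<bar>r * t\<bar> \<le> \<bar>r\<bar>"
  using assms mult_left_mono[of "\<bar>t\<bar>" 1 "\<bar>r\<bar>"] by (simp add: abs_mult abs_le_iff)

lemma sq_dist_ge:
  assumes "t \<in> {-1..1}"
  shows "(1 - \<bar>r\<bar>)\<^sup>2 \<le> sq_dist r t"
proof -
  have "r * t \<le> \<bar>r\<bar>"
    using abs_mult_le_abs[OF assms] by (rule order_trans[OF abs_ge_self])
  moreover have "(1 - \<bar>r\<bar>)\<^sup>2 = 1 + r\<^sup>2 - 2 * \<bar>r\<bar>"
    by (simp add: power2_diff)
  ultimately show ?thesis
    by (simp add: sq_dist_def)
qed

lemma sq_dist_pos: "\<bar>r\<bar> < 1 \<Longrightarrow> t \<in> {-1..1} \<Longrightarrow> 0 < sq_dist r t"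
  using sq_dist_ge[of t r] by (smt (verit) zero_less_power)

text \<open>The bound is uniform in \<open>r\<close>, as domination of the derivative in
  \<open>r\<close> requires. The upper value 4 dominates (1 + |r|)^2.\<close>

lemma sq_dist_powr_bound:
  assumes "\<bar>r\<bar> \<le> \<rho>" "\<rho> < 1" "t \<in> {-1..1}"
  shows "sq_dist r t powr a \<le> ((1 - \<rho>)\<^sup>2) powr a + 4 powr a"
proof (rule powr_Icc_bound)
  have "(1 - \<rho>)\<^sup>2 \<le> (1 - \<bar>r\<bar>)\<^sup>2"
    using assms by (intro power_mono) auto
  then show "(1 - \<rho>)\<^sup>2 \<le> sq_dist r t"
    using sq_dist_ge[OF assms(3), of r] by linarith
  have "- (r * t) \<le> \<bar>r\<bar>"
    using abs_mult_le_abs[OF assms(3)] by (rule order_trans[OF abs_ge_minus_self])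
  moreover have "r\<^sup>2 \<le> 1"
    using assms by (simp add: abs_square_le_1)
  ultimately show "sq_dist r t \<le> 4"
    using assms by (auto simp: sq_dist_def)
qed (use assms in auto)

definition sphere_mean :: "'n::finite \<Rightarrow> real \<Rightarrow> real \<Rightarrow> real" where
  "sphere_mean k s r = (\<integral>\<zeta>. sq_dist r (\<zeta> $ k) powr (- s) \<partial>(sphere_measure :: (real ^ 'n::finite) measure))"

lemma borel_measurable_sq_dist [measurable]: "sq_dist r \<in> borel_measurable borel"
  unfolding sq_dist_def by measurable

lemma integrable_sq_dist_powr:
  assumes "\<bar>r\<bar> < 1"
  shows "integrable (sphere_measure :: (real ^ 'n) measure) (\<lambda>\<zeta>. sq_dist r (\<zeta> $ k) powr a)"
proof (rule integrable_sphere_measure_bounded)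
  show "\<bar>sq_dist r (\<zeta> $ k) powr a\<bar> \<le> ((1 - \<bar>r\<bar>)\<^sup>2) powr a + 4 powr a" if "\<zeta> \<in> sphere 0 1" for \<zeta> :: "real ^ 'n"
    using sq_dist_powr_bound[OF order_refl assms sphere_component_bounds[OF that]] by simp
qed measurable

lemma sphere_mean_pos:
  fixes k :: "'n::finite"
  assumes "\<bar>r\<bar> < 1"
  shows "0 < sphere_mean k s r"
proof -
  interpret prob_space "sphere_measure :: (real ^ 'n) measure"
    by (rule prob_space_sphere_measure)
  have "(\<integral>\<zeta>. 0 \<partial>(sphere_measure :: (real ^ 'n) measure))
      < (\<integral>\<zeta>. sq_dist r (\<zeta> $ k) powr (- s) \<partial>(sphere_measure :: (real ^ 'n) measure))"
  proof (rule integral_less_AE_space)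
    show "AE \<zeta> in (sphere_measure :: (real ^ 'n) measure). 0 < sq_dist r (\<zeta> $ k) powr (- s)"
    proof (rule AE_I2)
      fix \<zeta> :: "real ^ 'n" assume "\<zeta> \<in> space sphere_measure"
      then have "\<zeta> \<in> sphere 0 1" by simp
      from sq_dist_pos[OF assms sphere_component_bounds[OF this, of k]]
      show "0 < sq_dist r (\<zeta> $ k) powr (- s)" by simp
    qed
    show "emeasure (sphere_measure :: (real ^ 'n) measure) (space sphere_measure) \<noteq> 0"
      by (simp add: emeasure_space_1 del: space_sphere_measure)
  qed (simp_all add: integrable_sq_dist_powr[OF assms])
  then show ?thesis by (simp add: sphere_mean_def)
qed

lemma sphere_mean_0 [simp]: "sphere_mean k s 0 = 1"
proof -
  interpret prob_space "sphere_measure :: (real ^ 'a) measure"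
    by (rule prob_space_sphere_measure)
  show ?thesis
    using prob_space by (simp add: sphere_mean_def sq_dist_def)
qed

text \<open>This form of the derivative is valid at \<open>r = 0\<close> as well and so supplies
  continuity there.\<close>

lemma DERIV_sphere_mean_integral:
  assumes r: "\<bar>r\<bar> < 1"
  shows "(sphere_mean k s has_real_derivative
    (\<integral>\<zeta>. - s * sq_dist r (\<zeta> $ k) powr (- s - 1) * (2 * r - 2 * \<zeta> $ k) \<partial>(sphere_measure :: (real ^ 'n) measure))) (at r)"
proof -
  interpret prob_space "sphere_measure :: (real ^ 'n) measure"
    by (rule prob_space_sphere_measure)
  \<comment> \<open>The midpoint of |r| and 1 leaves room around \<open>r\<close> and keeps the
    distance bounded away from 0.\<close>
  define \<rho> where "\<rho> = (1 + \<bar>r\<bar>) / 2"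
  have \<rho>: "\<bar>r\<bar> < \<rho>" "\<rho> < 1" using r by (auto simp: \<rho>_def)
  let ?B = "((1 - \<rho>)\<^sup>2) powr (- s - 1) + 4 powr (- s - 1)"
  show ?thesis
    unfolding sphere_mean_def[abs_def]
  proof (rule has_real_derivative_integral[where S = "{-\<rho><..<\<rho>}" and C = "\<bar>s\<bar> * ?B * 4"])
    show "r \<in> {-\<rho><..<\<rho>}" using \<rho> by auto
    fix y assume y: "y \<in> {-\<rho><..<\<rho>}"
    then have y1: "\<bar>y\<bar> < 1" and y2: "\<bar>y\<bar> \<le> \<rho>" using \<rho> by auto
    show "integrable (sphere_measure :: (real ^ 'n) measure) (\<lambda>\<zeta>. sq_dist y (\<zeta> $ k) powr - s)"
      by (rule integrable_sq_dist_powr[OF y1])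
    fix \<zeta> :: "real ^ 'n" assume "\<zeta> \<in> space sphere_measure"
    then have t: "\<zeta> $ k \<in> {-1..1}"
      using sphere_component_bounds[of \<zeta> k] by simp
    have "((\<lambda>y. sq_dist y (\<zeta> $ k)) has_real_derivative 2 * y - 2 * \<zeta> $ k) (at y)"
      unfolding sq_dist_def by (auto intro!: derivative_eq_intros)
    from DERIV_fun_powr[OF this sq_dist_pos[OF y1 t], of "- s"]
    show "((\<lambda>y. sq_dist y (\<zeta> $ k) powr (- s)) has_real_derivative
        - s * sq_dist y (\<zeta> $ k) powr (- s - 1) * (2 * y - 2 * \<zeta> $ k)) (at y)"
      by simp
    have "\<bar>2 * y - 2 * \<zeta> $ k\<bar> \<le> 4" using t y1 by auto
    then show "\<bar>- s * sq_dist y (\<zeta> $ k) powr (- s - 1) * (2 * y - 2 * \<zeta> $ k)\<bar> \<le> \<bar>s\<bar> * ?B * 4"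
      using sq_dist_powr_bound[OF y2 \<rho>(2) t, of "- s - 1"]
      unfolding abs_mult by (intro mult_mono) auto
  qed auto
qed

text \<open>With D for the squared distance, r (2 r - 2 t) = D - (1 - r^2). This trades the inner
  derivative for a shift of the exponent, at the price of dividing by \<open>r\<close>.\<close>

lemma DERIV_sphere_mean:
  assumes r: "\<bar>r\<bar> < 1" "r \<noteq> 0"
  shows "(sphere_mean k s has_real_derivative
    (s * (1 - r\<^sup>2) * sphere_mean k (s + 1) r - s * sphere_mean k s r) / r) (at r)"
proof -
  let ?\<sigma> = "sphere_measure :: (real ^ 'a) measure"
  let ?D = "\<lambda>\<zeta>::real ^ 'a. sq_dist r (\<zeta> $ k)"
  have "(\<integral>\<zeta>. - s * ?D \<zeta> powr (- s - 1) * (2 * r - 2 * \<zeta> $ k) \<partial>?\<sigma>)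
     = (\<integral>\<zeta>. (s * (1 - r\<^sup>2) / r) * ?D \<zeta> powr (- (s + 1)) - s / r * ?D \<zeta> powr (- s) \<partial>?\<sigma>)"
  proof (rule Bochner_Integration.integral_cong)
    fix \<zeta> :: "real ^ 'a" assume "\<zeta> \<in> space sphere_measure"
    then have t: "\<zeta> $ k \<in> {-1..1}"
      using sphere_component_bounds[of \<zeta> k] by simp
    have e: "?D \<zeta> powr (- s) = ?D \<zeta> * ?D \<zeta> powr (- s - 1)"
      using sq_dist_pos[OF r(1) t] by (simp add: powr_mult_base)
    show "- s * ?D \<zeta> powr (- s - 1) * (2 * r - 2 * \<zeta> $ k)
        = (s * (1 - r\<^sup>2) / r) * ?D \<zeta> powr (- (s + 1)) - s / r * ?D \<zeta> powr (- s)"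
    proof -
      define E where "E = ?D \<zeta> powr (- s - 1)"
      have "?D \<zeta> powr (- (s + 1)) = E" by (simp add: E_def)
      moreover have "s * (1 - r\<^sup>2) * E - s * (?D \<zeta> * E) = r * (- s * E * (2 * r - 2 * \<zeta> $ k))"
        by (simp add: sq_dist_def power2_eq_square algebra_simps)
      then have "(s * (1 - r\<^sup>2) * E - s * (?D \<zeta> * E)) / r = - s * E * (2 * r - 2 * \<zeta> $ k)"
        using r by (metis nonzero_mult_div_cancel_left)
      ultimately show ?thesis
        unfolding e E_def[symmetric] by (simp add: diff_divide_distrib)
    qed
  qed simp
  also have "\<dots> = (s * (1 - r\<^sup>2) * sphere_mean k (s + 1) r - s * sphere_mean k s r) / r"
    by (simp add: sphere_mean_def Bochner_Integration.integral_diff integrable_sq_dist_powr[OF r(1)] diff_divide_distrib)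
  finally show ?thesis
    using DERIV_sphere_mean_integral[OF r(1), of k s] by simp
qed

text \<open>Integrate by parts with \<psi> = D^(-s), where D is the squared distance, and multiply
  by 2 r. The coordinate t is then eliminated by 2 r t = 1 + r^2 - D and 4 r^2 (1 - t^2) = 2 (1 +
  r^2) D - (1 - r^2)^2 - D^2, which leaves only means of powers of D.\<close>

lemma sphere_mean_recurrence:
  fixes k :: "'n::finite"
  assumes r: "\<bar>r\<bar> < 1"
  shows "s * (1 - r\<^sup>2)\<^sup>2 * sphere_mean k (s + 1) r
    = (2 * s - real CARD('n) + 1) * (1 + r\<^sup>2) * sphere_mean k s r - (s - real CARD('n) + 1) * sphere_mean k (s - 1) r"
proof -
  let ?\<sigma> = "sphere_measure :: (real ^ 'n) measure"
  let ?D = "\<lambda>\<zeta>::real ^ 'n. sq_dist r (\<zeta> $ k)"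
  have e: "?D \<zeta> powr (- s) = ?D \<zeta> * ?D \<zeta> powr (- (s + 1))"
      "?D \<zeta> powr (- (s - 1)) = ?D \<zeta> * ?D \<zeta> powr (- s)" if "\<zeta> \<in> space ?\<sigma>" for \<zeta> :: "real ^ 'n"
    using sq_dist_pos[OF r, of "\<zeta> $ k"] sphere_component_bounds[of \<zeta> k] that by (simp_all add: powr_mult_base)
  have parts: "(real CARD('n) - 1) * (\<integral>\<zeta>. \<zeta> $ k * ?D \<zeta> powr (- s) \<partial>?\<sigma>)
      = (\<integral>\<zeta>. (1 - (\<zeta> $ k)\<^sup>2) * (2 * r * s * ?D \<zeta> powr (- (s + 1))) \<partial>?\<sigma>)"
  proof (rule integral_sphere_by_parts)
    show "continuous_on {-1..1} (\<lambda>t. 2 * r * s * sq_dist r t powr (- (s + 1)))"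
      using sq_dist_pos[OF r] unfolding sq_dist_def by (intro continuous_intros) force
    fix t :: real assume t: "t \<in> {-1..1}"
    have "((\<lambda>t. sq_dist r t) has_real_derivative - 2 * r) (at t)"
      unfolding sq_dist_def by (auto intro!: derivative_eq_intros)
    from DERIV_fun_powr[OF this sq_dist_pos[OF r t], of "- s"]
    show "((\<lambda>t. sq_dist r t powr (- s)) has_real_derivative 2 * r * s * sq_dist r t powr (- (s + 1))) (at t)"
      unfolding minus_add_distrib by (simp add: mult_ac)
  qed measurable
  have 1: "2 * r * (\<integral>\<zeta>. \<zeta> $ k * ?D \<zeta> powr (- s) \<partial>?\<sigma>) = (1 + r\<^sup>2) * sphere_mean k s r - sphere_mean k (s - 1) r"
  proof -
    have "2 * r * (\<integral>\<zeta>. \<zeta> $ k * ?D \<zeta> powr (- s) \<partial>?\<sigma>) = (\<integral>\<zeta>. 2 * r * (\<zeta> $ k * ?D \<zeta> powr (- s)) \<partial>?\<sigma>)"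
      by simp
    also have "\<dots> = (\<integral>\<zeta>. (1 + r\<^sup>2) * ?D \<zeta> powr (- s) - ?D \<zeta> powr (- (s - 1)) \<partial>?\<sigma>)"
      by (intro Bochner_Integration.integral_cong refl)
        (simp only: e(2), simp add: sq_dist_def algebra_simps)
    also have "\<dots> = (1 + r\<^sup>2) * sphere_mean k s r - sphere_mean k (s - 1) r"
      using integrable_sq_dist_powr[OF r, of k "- (s - 1)"]
      by (simp add: sphere_mean_def Bochner_Integration.integral_diff integrable_sq_dist_powr[OF r])
    finally show ?thesis .
  qed
  have 2: "2 * r * (\<integral>\<zeta>. (1 - (\<zeta> $ k)\<^sup>2) * (2 * r * s * ?D \<zeta> powr (- (s + 1))) \<partial>?\<sigma>)
      = s * (2 * (1 + r\<^sup>2) * sphere_mean k s r - (1 - r\<^sup>2)\<^sup>2 * sphere_mean k (s + 1) r - sphere_mean k (s - 1) r)"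
  proof -
    have "2 * r * (\<integral>\<zeta>. (1 - (\<zeta> $ k)\<^sup>2) * (2 * r * s * ?D \<zeta> powr (- (s + 1))) \<partial>?\<sigma>)
        = (\<integral>\<zeta>. 2 * r * ((1 - (\<zeta> $ k)\<^sup>2) * (2 * r * s * ?D \<zeta> powr (- (s + 1)))) \<partial>?\<sigma>)"
      by (rule Bochner_Integration.integral_mult_right_zero[symmetric])
    also have "\<dots> = (\<integral>\<zeta>. s * (2 * (1 + r\<^sup>2) * ?D \<zeta> powr (- s) - (1 - r\<^sup>2)\<^sup>2 * ?D \<zeta> powr (- (s + 1)) - ?D \<zeta> powr (- (s - 1))) \<partial>?\<sigma>)"
      by (intro Bochner_Integration.integral_cong refl)
        (simp only: e, simp add: sq_dist_def power2_eq_square algebra_simps)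
    also have "\<dots> = s * (2 * (1 + r\<^sup>2) * sphere_mean k s r - (1 - r\<^sup>2)\<^sup>2 * sphere_mean k (s + 1) r - sphere_mean k (s - 1) r)"
      using integrable_sq_dist_powr[OF r, of k "- (s - 1)"] integrable_sq_dist_powr[OF r, of k "- (s + 1)"]
      by (simp add: sphere_mean_def Bochner_Integration.integral_diff integrable_sq_dist_powr[OF r])
    finally show ?thesis .
  qed
  have "(real CARD('n) - 1) * ((1 + r\<^sup>2) * sphere_mean k s r - sphere_mean k (s - 1) r)
      = s * (2 * (1 + r\<^sup>2) * sphere_mean k s r - (1 - r\<^sup>2)\<^sup>2 * sphere_mean k (s + 1) r - sphere_mean k (s - 1) r)"
    unfolding 1[symmetric] 2[symmetric] parts[symmetric] by simp
  then show ?thesis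
    by (simp add: algebra_simps)
qed

section \<open>The hypergeometric equation\<close>

definition hyp_coeff :: "real \<Rightarrow> real \<Rightarrow> real \<Rightarrow> nat \<Rightarrow> real" where
  "hyp_coeff a b c k = pochhammer a k * pochhammer b k / (fact k * pochhammer c k)"

lemma hypergeometric_2F1_eq: "hypergeometric_2F1 a b c t = (\<Sum>k. hyp_coeff a b c k * t ^ k)"
  by (simp add: hypergeometric_2F1_def hyp_coeff_def)

lemma hyp_coeff_Suc:
  assumes "c > 0"
  shows "real (Suc k) * (c + real k) * hyp_coeff a b c (Suc k) = (a + real k) * (b + real k) * hyp_coeff a b c k"
  using assms pochhammer_pos[OF assms, of k]
  by (simp add: hyp_coeff_def pochhammer_Suc field_simps add_pos_nonneg less_imp_neq[symmetric])

text \<open>Ratio test: the quotients of successive terms tend to \<open>t\<close>, and (1 + |t|) /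
  2 lies strictly between |t| and 1.\<close>

lemma summable_hyp_coeff:
  assumes c: "c > 0" and t: "\<bar>t\<bar> < 1"
  shows "summable (\<lambda>k. hyp_coeff a b c k * t ^ k)"
proof -
  let ?q = "\<lambda>k. ((a + real k) * (b + real k)) / (real (Suc k) * (c + real k)) * t"
  have "((\<lambda>k. ((a + real k) * (b + real k)) / (real (Suc k) * (c + real k))) \<longlongrightarrow> 1) sequentially"
    by real_asymp
  then have "((\<lambda>k. \<bar>?q k\<bar>) \<longlongrightarrow> \<bar>1 * t\<bar>) sequentially"
    by (intro tendsto_intros)
  then have "eventually (\<lambda>k. \<bar>?q k\<bar> < (1 + \<bar>t\<bar>) / 2) sequentially"
    using t by (intro order_tendstoD(2)) auto
  then obtain N where N: "\<And>k. k \<ge> N \<Longrightarrow> \<bar>?q k\<bar> < (1 + \<bar>t\<bar>) / 2"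
    by (auto simp: eventually_sequentially)
  show ?thesis
  proof (rule summable_ratio_test)
    show "(1 + \<bar>t\<bar>) / 2 < 1" using t by simp
    fix k assume k: "k \<ge> N"
    have "hyp_coeff a b c (Suc k) * t ^ Suc k = ?q k * (hyp_coeff a b c k * t ^ k)"
      using hyp_coeff_Suc[OF c, of k a b] c by (simp add: field_simps add_pos_nonneg less_imp_neq[symmetric])
    then have "norm (hyp_coeff a b c (Suc k) * t ^ Suc k) = \<bar>?q k\<bar> * norm (hyp_coeff a b c k * t ^ k)"
      by (simp only: real_norm_def abs_mult)
    also have "\<dots> \<le> (1 + \<bar>t\<bar>) / 2 * norm (hyp_coeff a b c k * t ^ k)"
      using N[OF k] by (intro mult_right_mono) auto
    finally show "norm (hyp_coeff a b c (Suc k) * t ^ Suc k) \<le> (1 + \<bar>t\<bar>) / 2 * norm (hyp_coeff a b c k * t ^ k)" .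
  qed
qed

lemma hypergeometric_2F1_0 [simp]: "hypergeometric_2F1 a b c 0 = 1"
  unfolding hypergeometric_2F1_eq by (subst powser_zero) (simp add: hyp_coeff_def)

text \<open>Compare coefficients: those of t Y'' + c Y' are (a + k) (b + k) h_k by the recurrence,
  and (a + k) (b + k) = k (k - 1) + (a + b + 1) k + a b expresses the same series through t^2 Y'', t
  Y' and Y.\<close>

lemma hypergeometric_2F1_ode:
  assumes c: "c > 0"
  obtains Y' Y'' where
    "\<And>t. \<bar>t\<bar> < 1 \<Longrightarrow> (hypergeometric_2F1 a b c has_real_derivative Y' t) (at t)"
    "\<And>t. \<bar>t\<bar> < 1 \<Longrightarrow> (Y' has_real_derivative Y'' t) (at t)"
    "\<And>t. \<bar>t\<bar> < 1 \<Longrightarrow> t * (1 - t) * Y'' t + (c - (a + b + 1) * t) * Y' t = a * b * hypergeometric_2F1 a b c t"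
proof
  define h where "h = hyp_coeff a b c"
  have h0: "summable (\<lambda>k. h k * t ^ k)" if "\<bar>t\<bar> < 1" for t
    unfolding h_def by (rule summable_hyp_coeff[OF c that])
  have h1: "summable (\<lambda>k. diffs h k * t ^ k)" if "\<bar>t\<bar> < 1" for t
    by (rule termdiff_converges[where K = 1]) (use that h0 in auto)
  have h2: "summable (\<lambda>k. diffs (diffs h) k * t ^ k)" if "\<bar>t\<bar> < 1" for t
    by (rule termdiff_converges[where K = 1]) (use that h1 in auto)
  have Y: "hypergeometric_2F1 a b c = (\<lambda>t. \<Sum>k. h k * t ^ k)"
    by (auto simp: hypergeometric_2F1_eq h_def)
  define Y' where "Y' t = (\<Sum>k. diffs h k * t ^ k)" for t
  define Y'' where "Y'' t = (\<Sum>k. diffs (diffs h) k * t ^ k)" for t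
  show "(hypergeometric_2F1 a b c has_real_derivative Y' t) (at t)" if "\<bar>t\<bar> < 1" for t
    unfolding Y Y'_def by (rule termdiffs_strong'[where K = 1]) (use that h0 in auto)
  show "(Y' has_real_derivative Y'' t) (at t)" if "\<bar>t\<bar> < 1" for t
    unfolding Y'_def[abs_def] Y''_def by (rule termdiffs_strong'[where K = 1]) (use that h1 in auto)
  show "t * (1 - t) * Y'' t + (c - (a + b + 1) * t) * Y' t = a * b * hypergeometric_2F1 a b c t" if t: "\<bar>t\<bar> < 1" for t
  proof -
    define f where "f k = real k * (real k + c - 1) * h k * t ^ k" for k
    define g where "g k = (real k + a) * (real k + b) * h k * t ^ k" for k
    have s0: "(\<lambda>k. h k * t ^ k) sums hypergeometric_2F1 a b c t"
      unfolding Y using h0[OF t] by (rule summable_sums)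
    have s1: "(\<lambda>k. diffs h k * t ^ k) sums Y' t"
      unfolding Y'_def using h1[OF t] by (rule summable_sums)
    have s2: "(\<lambda>k. diffs (diffs h) k * t ^ k) sums Y'' t"
      unfolding Y''_def using h2[OF t] by (rule summable_sums)
    \<comment> \<open>Multiplication by \<open>t\<close> shifts the index by one; the new term at 0
      vanishes because of the factor \<open>real k\<close>.\<close>
    have s1': "(\<lambda>k. real k * h k * t ^ k) sums (t * Y' t)"
      using sums_mult[OF s1, of t] by - (rule sums_Suc_imp, simp_all add: diffs_def mult_ac)
    have s2': "(\<lambda>k. real k * diffs h k * t ^ k) sums (t * Y'' t)"
      using sums_mult[OF s2, of t] by - (rule sums_Suc_imp, simp_all add: diffs_def mult_ac)
    have s2'': "(\<lambda>k. real k * (real k - 1) * h k * t ^ k) sums (t * (t * Y'' t))"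
      using sums_mult[OF s2', of t] by - (rule sums_Suc_imp, simp_all add: diffs_def mult_ac)
    have "(\<lambda>k. (real k + c) * diffs h k * t ^ k) sums (t * Y'' t + c * Y' t)"
      using sums_add[OF s2' sums_mult[OF s1, of c]] by (simp add: algebra_simps)
    also have "(\<lambda>k. (real k + c) * diffs h k * t ^ k) = (\<lambda>k. (a + real k) * (b + real k) * h k * t ^ k)"
      using hyp_coeff_Suc[OF c, of _ a b] by (auto simp: diffs_def h_def mult_ac add_ac)
    finally have "(\<lambda>k. (a + real k) * (b + real k) * h k * t ^ k) sums (t * Y'' t + c * Y' t)" .
    moreover have "(\<lambda>k. (a + real k) * (b + real k) * h k * t ^ k) sums
        (t * (t * Y'' t) + (a + b + 1) * (t * Y' t) + a * b * hypergeometric_2F1 a b c t)"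
      using sums_add[OF sums_add[OF s2'' sums_mult[OF s1', of "a + b + 1"]] sums_mult[OF s0, of "a * b"]]
      by (simp add: algebra_simps)
    ultimately have "t * Y'' t + c * Y' t = t * (t * Y'' t) + (a + b + 1) * (t * Y' t) + a * b * hypergeometric_2F1 a b c t"
      by (rule sums_unique2)
    then show ?thesis by (simp add: algebra_simps)
  qed
qed

text \<open>Both sides are solutions regular at 0 of one singular second-order equation, with value
  1 there. Their Wronskian vanishes, so their quotient \<open>Q\<close> is constant.\<close>

lemma hypergeometric_2F1_sphere_mean:
  fixes k :: "'n::finite" and s :: real
  defines "n \<equiv> real CARD('n)"
  assumes n3: "CARD('n) \<ge> 3" and r: "0 \<le> r" "r < 1"
  shows "hypergeometric_2F1 (n - 1 - s) (n / 2 - s) (n / 2) (r\<^sup>2)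
    = (1 - r\<^sup>2) powr (2 * s - n + 1) * sphere_mean k s r"
proof -
  \<comment> \<open>The Wronskian carries the power n - 2, which is \<open>N + 1\<close> and hence
    positive.\<close>
  define N where "N = CARD('n) - 3"
  have n: "n = real N + 3" and n0: "n > 0" using n3 by (auto simp: n_def N_def)
  \<comment> \<open>Here \<open>m = c - a - b\<close>, the nonzero exponent of the hypergeometric
    equation at 1 when it does not vanish.\<close>
  define a b c m where "a = n - 1 - s" and "b = n / 2 - s" and "c = n / 2" and "m = 2 * s - n + 1"
  note abcm = a_def b_def c_def m_def
  have c: "c > 0" using n0 by (simp add: c_def)
  define Y where "Y = hypergeometric_2F1 a b c"
  obtain Y1 Y2 where
    Y: "\<And>t. \<bar>t\<bar> < 1 \<Longrightarrow> (Y has_real_derivative Y1 t) (at t)" and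
    Y1: "\<And>t. \<bar>t\<bar> < 1 \<Longrightarrow> (Y1 has_real_derivative Y2 t) (at t)" and
    ode: "\<And>t. \<bar>t\<bar> < 1 \<Longrightarrow> t * (1 - t) * Y2 t + (c - (a + b + 1) * t) * Y1 t = a * b * Y t"
    unfolding Y_def using hypergeometric_2F1_ode[OF c] by metis
  have sq: "\<bar>x\<^sup>2\<bar> < 1" if "\<bar>x\<bar> < 1" for x :: real
    using that by (simp add: abs_square_less_1)
  have Ysq: "((\<lambda>x. Y (x\<^sup>2)) has_real_derivative Y1 (x\<^sup>2) * (2 * x)) (at x)"
    and Y1sq: "((\<lambda>x. Y1 (x\<^sup>2)) has_real_derivative Y2 (x\<^sup>2) * (2 * x)) (at x)" if "\<bar>x\<bar> < 1" for x
    by (rule DERIV_chain2[where g = "\<lambda>x. x\<^sup>2", OF Y[OF sq[OF that]]]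
          DERIV_chain2[where g = "\<lambda>x. x\<^sup>2", OF Y1[OF sq[OF that]]];
        auto intro!: derivative_eq_intros)+
  define A where "A = sphere_mean k s"
  define B where "B = sphere_mean k (s + 1)"
  define A1 where "A1 x = (s * (1 - x\<^sup>2) * B x - s * A x) / x" for x
  define B1 where "B1 x = ((s + 1) * (1 - x\<^sup>2) * sphere_mean k (s + 2) x - (s + 1) * B x) / x" for x
  have A: "(A has_real_derivative A1 x) (at x)" if "\<bar>x\<bar> < 1" "x \<noteq> 0" for x
    using DERIV_sphere_mean[OF that, of k s] by (simp add: A_def B_def A1_def)
  have B: "(B has_real_derivative B1 x) (at x)" if "\<bar>x\<bar> < 1" "x \<noteq> 0" for x
    using DERIV_sphere_mean[OF that, of k "s + 1"] by (simp add: B_def B1_def add.commute)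
  have A1: "x * A1 x = s * (1 - x\<^sup>2) * B x - s * A x" if "x \<noteq> 0" for x
    using that by (simp add: A1_def)
  \<comment> \<open>The recurrence at \<open>s + 1\<close> eliminates the mean with exponent
    \<open>s + 2\<close> and so closes the system for \<open>A\<close> and \<open>B\<close>.\<close>
  have B1: "x * (1 - x\<^sup>2) * B1 x = (2 * s + 3 - n) * (1 + x\<^sup>2) * B x - (s + 2 - n) * A x - (1 - x\<^sup>2) * (s + 1) * B x"
    if "\<bar>x\<bar> < 1" "x \<noteq> 0" for x
  proof -
    have "x * (1 - x\<^sup>2) * B1 x = (s + 1) * (1 - x\<^sup>2)\<^sup>2 * sphere_mean k (s + 2) x - (1 - x\<^sup>2) * (s + 1) * B x"
    proof -
      have "x * B1 x = (s + 1) * (1 - x\<^sup>2) * sphere_mean k (s + 2) x - (s + 1) * B x"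
        using that by (simp add: B1_def)
      then show ?thesis by algebra
    qed
    moreover have "(s + 1) * (1 - x\<^sup>2)\<^sup>2 * sphere_mean k (s + 2) x
        = (2 * s + 3 - n) * (1 + x\<^sup>2) * B x - (s + 2 - n) * A x"
      using sphere_mean_recurrence[OF that(1), of "s + 1" k] unfolding n_def A_def B_def by (simp add: algebra_simps)
    ultimately show ?thesis by simp
  qed
  have contA: "isCont A x" and contB: "isCont B x" if "\<bar>x\<bar> < 1" for x
    unfolding A_def B_def using DERIV_isCont[OF DERIV_sphere_mean_integral[OF that]] by auto

  text \<open>
    \<open>x\<^sup>n\<^sup>-\<^sup>2 * G x\<close> is the Wronskian of \<open>A x\<close> and \<open>(1 - x\<^sup>2)\<^sup>-\<^sup>m * Y (x\<^sup>2)\<close>,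
    multiplied by the weight \<open>x\<^sup>n\<^sup>-\<^sup>1 * (1 - x\<^sup>2)\<^sup>m\<^sup>+\<^sup>1\<close> that makes it constant;
    the derivative of \<open>A\<close> is eliminated so that \<open>G\<close> is defined at \<open>0\<close>.
  \<close>
  define G where "G x = (1 - x\<^sup>2) * ((s * (1 - x\<^sup>2) * B x - s * A x) * Y (x\<^sup>2) - 2 * x\<^sup>2 * A x * Y1 (x\<^sup>2))
      - 2 * m * x\<^sup>2 * A x * Y (x\<^sup>2)" for x
  define G1 where "G1 x = - 2 * x * ((s * (1 - x\<^sup>2) * B x - s * A x) * Y (x\<^sup>2) - 2 * x\<^sup>2 * A x * Y1 (x\<^sup>2))
      + (1 - x\<^sup>2) * ((- 2 * x * s * B x + s * (1 - x\<^sup>2) * B1 x - s * A1 x) * Y (x\<^sup>2)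
        + (s * (1 - x\<^sup>2) * B x - s * A x) * (Y1 (x\<^sup>2) * (2 * x))
        - 4 * x * A x * Y1 (x\<^sup>2) - 2 * x\<^sup>2 * A1 x * Y1 (x\<^sup>2) - 2 * x\<^sup>2 * A x * (Y2 (x\<^sup>2) * (2 * x)))
      - 2 * m * (2 * x * A x * Y (x\<^sup>2) + x\<^sup>2 * A1 x * Y (x\<^sup>2) + x\<^sup>2 * A x * (Y1 (x\<^sup>2) * (2 * x)))" for x
  have G: "(G has_real_derivative G1 x) (at x)" if "\<bar>x\<bar> < 1" "x \<noteq> 0" for x
    unfolding G_def[abs_def]
    by (rule derivative_eq_intros A[OF that] B[OF that] Ysq[OF that(1)] Y1sq[OF that(1)] refl)+
      (simp add: G1_def power2_eq_square algebra_simps)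
  \<comment> \<open>Equivalently, \<open>x ^ (N + 1) * G x\<close> has derivative 0 away from
    0.\<close>
  have G1: "(real N + 1) * G x + x * G1 x = 0" if "\<bar>x\<bar> < 1" "x \<noteq> 0" for x
  proof -
    note a = A1[OF that(2)] and b = B1[OF that]
    have y: "x\<^sup>2 * (1 - x\<^sup>2) * Y2 (x\<^sup>2) = a * b * Y (x\<^sup>2) - (c - (a + b + 1) * x\<^sup>2) * Y1 (x\<^sup>2)"
      using ode[OF sq[OF that(1)]] by simp
    \<comment> \<open>The factors are grouped so that \<open>A1\<close>, \<open>B1\<close> and
      \<open>Y2\<close> occur only in the combinations that \<open>a\<close>, \<open>b\<close> and
      \<open>y\<close> rewrite; what remains is a polynomial identity.\<close>
    have "x * G1 x = - 2 * x\<^sup>2 * ((s * (1 - x\<^sup>2) * B x - s * A x) * Y (x\<^sup>2) - 2 * x\<^sup>2 * A x * Y1 (x\<^sup>2))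
      + (1 - x\<^sup>2) * ((- 2 * x\<^sup>2 * s * B x - s * (x * A1 x)) * Y (x\<^sup>2)
        + (s * (1 - x\<^sup>2) * B x - s * A x) * (Y1 (x\<^sup>2) * (2 * x\<^sup>2))
        - 4 * x\<^sup>2 * A x * Y1 (x\<^sup>2) - 2 * x\<^sup>2 * (x * A1 x) * Y1 (x\<^sup>2))
      + s * (1 - x\<^sup>2) * (x * (1 - x\<^sup>2) * B1 x) * Y (x\<^sup>2)
      - 4 * x\<^sup>2 * A x * (x\<^sup>2 * (1 - x\<^sup>2) * Y2 (x\<^sup>2))
      - 2 * m * (2 * x\<^sup>2 * A x * Y (x\<^sup>2) + x\<^sup>2 * (x * A1 x) * Y (x\<^sup>2) + x\<^sup>2 * A x * (Y1 (x\<^sup>2) * (2 * x\<^sup>2)))"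
      unfolding G1_def by algebra
    then show ?thesis
      unfolding a b y abcm n G_def by (simp add: field_simps power2_eq_square)
  qed
  \<comment> \<open>Regularity at 0 enters here: the constant function
    \<open>x ^ (N + 1) * G x\<close> is continuous up to 0 and vanishes there.\<close>
  have G0: "G x = 0" if x: "0 < x" "x < 1" for x
  proof -
    have "x ^ (N + 1) * G x = 0 ^ (N + 1) * G 0"
    proof (rule DERIV_isconst2[where a = 0 and b = x])
      show "continuous_on {0..x} (\<lambda>x. x ^ (N + 1) * G x)"
      proof (rule continuous_at_imp_continuous_on, rule ballI)
        fix y assume "y \<in> {0..x}"
        then have y: "\<bar>y\<bar> < 1" using x by auto
        have "isCont (\<lambda>x. Y (x\<^sup>2)) y" "isCont (\<lambda>x. Y1 (x\<^sup>2)) y"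
          using DERIV_isCont[OF Ysq[OF y]] DERIV_isCont[OF Y1sq[OF y]] .
        then show "isCont (\<lambda>x. x ^ (N + 1) * G x) y"
          unfolding G_def using contA[OF y] contB[OF y] by (intro continuous_intros)
      qed
      show "((\<lambda>x. x ^ (N + 1) * G x) has_real_derivative 0) (at y)" if "0 < y" "y < x" for y
      proof -
        have y: "\<bar>y\<bar> < 1" "y \<noteq> 0" using that x by auto
        have "((\<lambda>x. x ^ (N + 1) * G x) has_real_derivative y ^ N * ((real N + 1) * G y + y * G1 y)) (at y)"
          by (rule derivative_eq_intros G[OF y] refl)+ (simp add: algebra_simps)
        then show ?thesis by (simp add: G1[OF y])
      qed
    qed (use x in auto)
    then show ?thesis using x by simp
  qed
  have Apos: "A x > 0" if "\<bar>x\<bar> < 1" for x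
    unfolding A_def by (rule sphere_mean_pos[OF that])
  \<comment> \<open>The quotient of the two solutions, with \<open>A\<close> in the denominator
    because it is known to be positive.\<close>
  define Q where "Q x = Y (x\<^sup>2) * (1 - x\<^sup>2) powr (- m) / A x" for x
  have "Q r = Q 0"
  proof (cases "r = 0")
    case False
    with r have r: "0 < r" "r < 1" by auto
    show ?thesis
    proof (rule DERIV_isconst2[where a = 0 and b = r])
      show "continuous_on {0..r} Q"
      proof (rule continuous_at_imp_continuous_on, rule ballI)
        fix y assume "y \<in> {0..r}"
        then have y: "\<bar>y\<bar> < 1" using r by auto
        have "isCont (\<lambda>x. Y (x\<^sup>2)) y"
          using DERIV_isCont[OF Ysq[OF y]] .
        then show "isCont Q y"
          unfolding Q_def[abs_def] using contA[OF y] Apos[OF y] sq[OF y] by (intro continuous_intros) auto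
      qed
      show "(Q has_real_derivative 0) (at y)" if "0 < y" "y < r" for y
      proof -
        have y: "\<bar>y\<bar> < 1" "y \<noteq> 0" "0 < y" "y < 1" using that r by auto
        have pos: "1 - y\<^sup>2 > 0" using sq[OF y(1)] by auto
        have "((\<lambda>x. 1 - x\<^sup>2) has_real_derivative - 2 * y) (at y)"
          by (auto intro!: derivative_eq_intros)
        from DERIV_fun_powr[OF this pos, of "- m"]
        have P: "((\<lambda>x. (1 - x\<^sup>2) powr (- m)) has_real_derivative 2 * m * y * (1 - y\<^sup>2) powr (- m - 1)) (at y)"
          by (simp add: mult_ac)
        have e: "(1 - y\<^sup>2) powr (- m) = (1 - y\<^sup>2) * (1 - y\<^sup>2) powr (- m - 1)"
          using pos by (simp add: powr_mult_base)
        \<comment> \<open>Putting \<open>A1\<close> back into \<open>G y\<close> exposes a factor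
          \<open>y\<close>, which can be cancelled.\<close>
        have "y * ((1 - y\<^sup>2) * (A1 y * Y (y\<^sup>2) - 2 * y * A y * Y1 (y\<^sup>2)) - 2 * m * y * A y * Y (y\<^sup>2)) = 0"
          using G0[OF y(3,4)] unfolding G_def A1[OF y(2), symmetric] by algebra
        then have w: "(1 - y\<^sup>2) * (A1 y * Y (y\<^sup>2) - 2 * y * A y * Y1 (y\<^sup>2)) - 2 * m * y * A y * Y (y\<^sup>2) = 0"
          using y by simp
        have "(Q has_real_derivative
            ((Y1 (y\<^sup>2) * (2 * y) * (1 - y\<^sup>2) powr (- m) + 2 * m * y * (1 - y\<^sup>2) powr (- m - 1) * Y (y\<^sup>2)) * A y
              - Y (y\<^sup>2) * (1 - y\<^sup>2) powr (- m) * A1 y) / (A y * A y)) (at y)"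
          unfolding Q_def[abs_def] using Apos[OF y(1)]
          by (intro DERIV_divide DERIV_mult Ysq[OF y(1)] P A[OF y(1,2)]) auto
        \<comment> \<open>The numerator is \<open>- (1 - y\<^sup>2) powr (- m - 1)\<close> times the
          left side of \<open>w\<close>.\<close>
        moreover have "(Y1 (y\<^sup>2) * (2 * y) * (1 - y\<^sup>2) powr (- m) + 2 * m * y * (1 - y\<^sup>2) powr (- m - 1) * Y (y\<^sup>2)) * A y
              - Y (y\<^sup>2) * (1 - y\<^sup>2) powr (- m) * A1 y = 0"
          unfolding e using w by algebra
        ultimately show ?thesis by simp
      qed
    qed (use r in auto)
  qed simp
  also have "Q 0 = 1"
    by (simp add: Q_def Y_def A_def)
  finally have "Y (r\<^sup>2) * (1 - r\<^sup>2) powr (- m) = A r"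
    using Apos[of r] r by (simp add: Q_def field_simps)
  moreover have "(1 - r\<^sup>2) powr m * (1 - r\<^sup>2) powr (- m) = 1"
    using sq[of r] r by (simp flip: powr_add)
  ultimately have "Y (r\<^sup>2) = (1 - r\<^sup>2) powr m * A r"
    by (metis mult.commute mult.left_commute mult.right_neutral)
  then show ?thesis
    by (simp add: Y_def A_def abcm)
qed

section \<open>The sharp inequality\<close>

text \<open>Divide by the norms \<open>u\<close> and \<open>v\<close>, apply Young's inequality
  pointwise and integrate; Young's bound also gives integrability of the product. If a norm is 0,
  the product vanishes almost everywhere.\<close>

lemma Holder_inequality_integral:
  fixes f g :: "'a \<Rightarrow> real"
  assumes p: "p > 1" "q > 1" "1 / p + 1 / q = 1"
    and [measurable]: "f \<in> borel_measurable M" "g \<in> borel_measurable M"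
    and nonneg: "\<And>x. x \<in> space M \<Longrightarrow> 0 \<le> f x" "\<And>x. x \<in> space M \<Longrightarrow> 0 \<le> g x"
    and int: "integrable M (\<lambda>x. f x powr p)" "integrable M (\<lambda>x. g x powr q)"
  shows "(\<integral>x. f x * g x \<partial>M) \<le> (\<integral>x. f x powr p \<partial>M) powr (1 / p) * (\<integral>x. g x powr q \<partial>M) powr (1 / q)"
proof -
  define F G where "F = (\<integral>x. f x powr p \<partial>M)" and "G = (\<integral>x. g x powr q \<partial>M)"
  have FG: "F \<ge> 0" "G \<ge> 0" by (simp_all add: F_def G_def)
  show ?thesis
  proof (cases "F = 0 \<or> G = 0")
    case True
    then have "AE x in M. f x = 0 \<or> g x = 0"
    proof
      assume "F = 0"
      then have "AE x in M. f x powr p = 0"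
        unfolding F_def by (subst (asm) integral_nonneg_eq_0_iff_AE[OF int(1)]) auto
      then show ?thesis by eventually_elim simp
    next
      assume "G = 0"
      then have "AE x in M. g x powr q = 0"
        unfolding G_def by (subst (asm) integral_nonneg_eq_0_iff_AE[OF int(2)]) auto
      then show ?thesis by eventually_elim simp
    qed
    then have "(\<integral>x. f x * g x \<partial>M) = (\<integral>x. 0 \<partial>M)"
      by (intro integral_cong_AE) auto
    then show ?thesis by simp
  next
    case False
    then have FG: "F > 0" "G > 0" using FG by auto
    define u v where "u = F powr (1 / p)" and "v = G powr (1 / q)"
    have uv: "u > 0" "v > 0" "u powr p = F" "v powr q = G"
      using FG p by (simp_all add: u_def v_def powr_powr)
    have young: "f x * g x \<le> u * v * (f x powr p / (p * F) + g x powr q / (q * G))" if "x \<in> space M" for x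
    proof -
      have "(f x / u) * (g x / v) \<le> (f x / u) powr p / p + (g x / v) powr q / q"
        using uv nonneg[OF that] p by (intro Youngs_inequality) auto
      also have "(f x / u) powr p / p = f x powr p / (p * F)"
        using uv nonneg[OF that] by (simp add: powr_divide mult.commute)
      also have "(g x / v) powr q / q = g x powr q / (q * G)"
        using uv nonneg[OF that] by (simp add: powr_divide mult.commute)
      finally show ?thesis
        using uv by (simp add: pos_divide_le_eq mult.commute)
    qed
    have i: "integrable M (\<lambda>x. u * v * (f x powr p / (p * F) + g x powr q / (q * G)))"
      using int by auto
    have "(\<integral>x. f x * g x \<partial>M) \<le> (\<integral>x. u * v * (f x powr p / (p * F) + g x powr q / (q * G)) \<partial>M)"
    proof (rule integral_mono)
      show "integrable M (\<lambda>x. f x * g x)"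
        by (rule Bochner_Integration.integrable_bound[OF i]) (use young nonneg in \<open>auto intro!: AE_I2 order_trans[OF _ abs_ge_self]\<close>)
    qed (use i young in auto)
    also have "\<dots> = u * v * (F / (p * F) + G / (q * G))"
      using int by (simp add: F_def G_def)
    also have "\<dots> = u * v"
      using FG p by simp
    finally show ?thesis by (simp add: u_def v_def F_def G_def)
  qed
qed

section \<open>The kernel and the integrals of its powers\<close>

lemma inv_poisson_kernel_eq:
  fixes x \<zeta> :: "real ^ 'n"
  assumes x: "norm x < 1" and \<zeta>: "\<zeta> \<in> sphere 0 1"
  shows "inv_poisson_kernel x \<zeta> > 0"
    and "inv_poisson_kernel x \<zeta> powr q
      = (1 - (norm x)\<^sup>2) powr ((real CARD('n) - 1) * q) * ((norm (x - \<zeta>))\<^sup>2) powr - ((real CARD('n) - 1) * q)"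
proof -
  have pos: "1 - (norm x)\<^sup>2 > 0" "(norm (x - \<zeta>))\<^sup>2 > 0"
    using assms by (auto simp: abs_square_less_1)
  then show "inv_poisson_kernel x \<zeta> > 0"
    by (simp add: inv_poisson_kernel_def)
  have "inv_poisson_kernel x \<zeta> = ((1 - (norm x)\<^sup>2) / (norm (x - \<zeta>))\<^sup>2) powr (real CARD('n) - 1)"
    using pos unfolding inv_poisson_kernel_def by (subst powr_realpow[symmetric]) (auto simp: of_nat_diff)
  also have "\<dots> powr q = ((1 - (norm x)\<^sup>2) / (norm (x - \<zeta>))\<^sup>2) powr ((real CARD('n) - 1) * q)"
    by (rule powr_powr)
  finally show "inv_poisson_kernel x \<zeta> powr q
      = (1 - (norm x)\<^sup>2) powr ((real CARD('n) - 1) * q) * ((norm (x - \<zeta>))\<^sup>2) powr - ((real CARD('n) - 1) * q)"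
    using pos by (simp add: powr_divide powr_minus_divide)
qed

lemma borel_measurable_inv_poisson_kernel [measurable]:
  "inv_poisson_kernel (x :: real ^ 'n) \<in> borel_measurable borel"
  unfolding inv_poisson_kernel_def[abs_def] by measurable

lemma borel_measurable_sphere_measure_inv_poisson_kernel [measurable]:
  "inv_poisson_kernel (x :: real ^ 'n) \<in> borel_measurable sphere_measure"
  by (rule borel_measurable_sphere_measure) measurable

lemma inv_poisson_kernel_bound:
  fixes x \<zeta> :: "real ^ 'n"
  assumes x: "norm x < 1" and \<zeta>: "\<zeta> \<in> sphere 0 1"
  shows "inv_poisson_kernel x \<zeta> \<le> ((1 - (norm x)\<^sup>2) / (1 - norm x)\<^sup>2) ^ (CARD('n) - 1)"
proof -
  have "1 - norm x \<le> norm (x - \<zeta>)"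
    using \<zeta> norm_triangle_ineq2[of \<zeta> x] by (simp add: norm_minus_commute)
  moreover have "(norm x)\<^sup>2 \<le> 1" using x by (simp add: abs_square_le_1)
  ultimately show ?thesis
    using x unfolding inv_poisson_kernel_def
    by (intro power_mono divide_left_mono mult_pos_pos) (auto intro!: power_mono zero_less_power)
qed

lemma integrable_inv_poisson_kernel_powr:
  fixes x :: "real ^ 'n"
  assumes x: "norm x < 1" and q: "0 \<le> q"
  shows "integrable sphere_measure (\<lambda>\<zeta>. inv_poisson_kernel x \<zeta> powr q)"
proof (rule integrable_sphere_measure_bounded)
  fix \<zeta> :: "real ^ 'n" assume \<zeta>: "\<zeta> \<in> sphere 0 1"
  show "\<bar>inv_poisson_kernel x \<zeta> powr q\<bar> \<le> (((1 - (norm x)\<^sup>2) / (1 - norm x)\<^sup>2) ^ (CARD('n) - 1)) powr q"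
    using inv_poisson_kernel_bound[OF x \<zeta>] inv_poisson_kernel_eq(1)[OF x \<zeta>] q by (auto intro: powr_mono2)
qed measurable

text \<open>Rotating \<open>x\<close> onto a coordinate axis turns the integral into (1 - r^2)^s
  A_s(r) with s = (n - 1) q, and A_s(r) is known from the hypergeometric evaluation.\<close>

lemma integral_inv_poisson_kernel_powr:
  fixes x :: "real ^ 'n"
  assumes n3: "CARD('n) \<ge> 3" and x: "norm x < 1"
  defines "I \<equiv> \<lambda>q. \<integral>\<zeta>. inv_poisson_kernel x \<zeta> powr q \<partial>sphere_measure"
  shows "I q = C_const q x * (1 - (norm x)\<^sup>2) powr (- (real CARD('n) - 1) * (q - 1))"
    and "I q > 0"
proof -
  define n where "n = real CARD('n)"
  define r where "r = norm x"
  have r: "0 \<le> r" "r < 1" "\<bar>r\<bar> < 1" using x by (auto simp: r_def)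
  have pos: "1 - r\<^sup>2 > 0" using r by (simp add: abs_square_less_1)
  fix k :: 'n
  have "norm x = norm (r *\<^sub>R axis k 1 :: real ^ 'n)"
    by (simp add: r_def)
  then obtain f :: "real ^ 'n \<Rightarrow> real ^ 'n"
    where f: "orthogonal_transformation f" "f x = r *\<^sub>R axis k 1"
    by (rule orthogonal_transformation_exists)
  define s where "s = (n - 1) * q"
  have "I q = (\<integral>\<zeta>. (1 - r\<^sup>2) powr s * sq_dist r (f \<zeta> $ k) powr - s \<partial>(sphere_measure :: (real ^ 'n) measure))"
    unfolding I_def
  proof (rule Bochner_Integration.integral_cong)
    fix \<zeta> :: "real ^ 'n" assume "\<zeta> \<in> space sphere_measure"
    then have \<zeta>: "\<zeta> \<in> sphere 0 1" by simp
    have "x \<bullet> \<zeta> = f x \<bullet> f \<zeta>"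
      using f(1) by (simp add: orthogonal_transformation_def)
    also have "\<dots> = r * f \<zeta> $ k"
      by (simp add: f(2) inner_axis')
    finally have "(norm (x - \<zeta>))\<^sup>2 = sq_dist r (f \<zeta> $ k)"
      using \<zeta> by (simp add: sq_dist_def power2_norm_eq_inner inner_diff inner_commute r_def norm_eq_1)
    then show "inv_poisson_kernel x \<zeta> powr q = (1 - r\<^sup>2) powr s * sq_dist r (f \<zeta> $ k) powr - s"
      using inv_poisson_kernel_eq(2)[OF x \<zeta>, of q] by (simp add: r_def s_def n_def)
  qed simp
  also have "\<dots> = (1 - r\<^sup>2) powr s * (\<integral>\<zeta>. sq_dist r (f \<zeta> $ k) powr - s \<partial>(sphere_measure :: (real ^ 'n) measure))"
    by simp
  also have "(\<integral>\<zeta>. sq_dist r (f \<zeta> $ k) powr - s \<partial>(sphere_measure :: (real ^ 'n) measure)) = sphere_mean k s r"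
    unfolding sphere_mean_def
    by (rule integral_sphere_measure_orthogonal[OF f(1), where g = "\<lambda>\<zeta>. sq_dist r (\<zeta> $ k) powr - s"]) measurable
  finally have I: "I q = (1 - r\<^sup>2) powr s * sphere_mean k s r" .
  then show "I q > 0"
    using sphere_mean_pos[OF r(3), of k s] pos by simp
  have "C_const q x = hypergeometric_2F1 (n - 1 - s) (n / 2 - s) (n / 2) (r\<^sup>2)"
    unfolding C_const_def Let_def n_def[symmetric] r_def[symmetric]
    by (rule arg_cong2[where f = "\<lambda>a b. hypergeometric_2F1 a b _ _"]) (simp_all add: s_def algebra_simps)
  also have "\<dots> = (1 - r\<^sup>2) powr (2 * s - n + 1) * sphere_mean k s r"
    unfolding n_def by (rule hypergeometric_2F1_sphere_mean[OF n3 r(1,2)])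
  finally have C: "C_const q x = (1 - r\<^sup>2) powr (2 * s - n + 1) * sphere_mean k s r" .
  \<comment> \<open>The power of 1 - r^2 not absorbed by \<open>C_const\<close> has exponent s - (2
    s - n + 1) = - (n - 1) (q - 1).\<close>
  have "s = 2 * s - n + 1 + (- (n - 1) * (q - 1))"
    by (simp add: s_def algebra_simps)
  then have "(1 - r\<^sup>2) powr s = (1 - r\<^sup>2) powr (2 * s - n + 1) * (1 - r\<^sup>2) powr (- (n - 1) * (q - 1))"
    by (metis powr_add)
  then show "I q = C_const q x * (1 - (norm x)\<^sup>2) powr (- (real CARD('n) - 1) * (q - 1))"
    unfolding I C r_def[symmetric] n_def[symmetric] by (simp only: mult_ac)
qed

text \<open>Translates the relation in \<open>ennreal\<close> into real arithmetic: 1 / \<infinity>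
  = 0 forces \<open>q = 1\<close>, and a finite \<open>p\<close> excludes it.\<close>

lemma conjugate_exponent_cases:
  fixes p :: ennreal
  assumes "1 < p" "1 \<le> q" "1 / p + 1 / ennreal q = 1"
  obtains "p = \<infinity>" "q = 1"
  | p' where "p = ennreal p'" "1 < p'" "1 < q" "1 / p' + 1 / q = 1"
proof (cases p)
  case (real p')
  have p': "1 < p'"
    using assms(1) real by (simp flip: ennreal_1 add: ennreal_less_iff)
  have "ennreal (1 / p') + ennreal (1 / q) = ennreal 1"
    using assms(2,3) p' real by (simp add: divide_ennreal flip: ennreal_1)
  then have e: "1 / p' + 1 / q = 1"
    using assms(2) p' by (subst (asm) ennreal_plus[symmetric]) (auto simp: ennreal_inj simp del: ennreal_plus)
  moreover have "q \<noteq> 1" using e p' by auto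
  ultimately show ?thesis
    using that(2)[OF real(2) p'] assms(2) by simp
next
  case top
  then have "ennreal (1 / q) = ennreal 1"
    using assms(2,3) by (simp add: divide_ennreal flip: ennreal_1)
  then have "q = 1"
    using assms(2) by (subst (asm) ennreal_inj) auto
  then show ?thesis using that(1) top by simp
qed

text \<open>Taking the root of order \<open>q\<close> turns the exponent - (n - 1) (q - 1) into - (n
  - 1) / p, because (q - 1) / q = 1 / p.\<close>

lemma sharp_const_eq:
  fixes x :: "real ^ 'n"
  assumes n3: "CARD('n) \<ge> 3" and x: "norm x < 1"
    and pq: "1 < p" "1 \<le> q" "1 / p + 1 / ennreal q = 1"
  shows "sharp_const p q x = (\<integral>\<zeta>. inv_poisson_kernel x \<zeta> powr q \<partial>sphere_measure) powr (1 / q)"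
proof -
  define I where "I = (\<integral>\<zeta>. inv_poisson_kernel x \<zeta> powr q \<partial>sphere_measure)"
  define d where "d = 1 - (norm x)\<^sup>2"
  have d: "d > 0" using x by (simp add: d_def abs_square_less_1)
  have I: "I = C_const q x * d powr (- (real CARD('n) - 1) * (q - 1))" "I > 0"
    using integral_inv_poisson_kernel_powr[OF n3 x, of q] unfolding I_def d_def by simp_all
  \<comment> \<open>Positivity is read off from the integral rather than from the series.\<close>
  then have "C_const q x > 0"
    using d by (simp add: zero_less_mult_iff)
  then have eq: "I powr (1 / q) = C_const q x powr (1 / q) * d powr (- (real CARD('n) - 1) * (q - 1) * (1 / q))"
    unfolding I(1) using d by (simp add: powr_mult powr_powr)
  have "- (real CARD('n) - 1) * (q - 1) * (1 / q) = - enn2real (of_nat (CARD('n) - 1) / p)"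
    using pq
  proof (cases rule: conjugate_exponent_cases)
    case 1
    then show ?thesis by simp
  next
    case (2 p')
    have "of_nat (CARD('n) - 1) / p = ennreal ((real CARD('n) - 1) / p')"
      using 2 by (simp add: ennreal_of_nat_eq_real_of_nat divide_ennreal of_nat_diff)
    then have "enn2real (of_nat (CARD('n) - 1) / p) = (real CARD('n) - 1) * (1 / p')"
      using 2 n3 by simp
    also have "1 / p' = (q - 1) * (1 / q)"
      using 2 by (simp add: field_simps)
    finally show ?thesis
      by (simp only: mult.assoc mult_minus_left)
  qed
  then show ?thesis
    using d unfolding I_def[symmetric] eq by (simp add: sharp_const_def d_def[symmetric] powr_minus_divide)
qed

text \<open>This covers non-integrable integrands too, whose Bochner integral is 0 by
  convention.\<close>

lemma norm_inv_poisson_integral_le: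
  fixes x :: "real ^ 'n"
  assumes x: "norm x < 1"
  shows "norm (inv_poisson_integral \<phi> x) \<le> (\<integral>\<zeta>. norm (\<phi> \<zeta>) * inv_poisson_kernel x \<zeta> \<partial>sphere_measure)"
proof -
  have "norm (inv_poisson_integral \<phi> x) \<le> (\<integral>\<zeta>. norm (inv_poisson_kernel x \<zeta> *\<^sub>R \<phi> \<zeta>) \<partial>sphere_measure)"
    unfolding inv_poisson_integral_def by (rule integral_norm_bound)
  also have "\<dots> = (\<integral>\<zeta>. norm (\<phi> \<zeta>) * inv_poisson_kernel x \<zeta> \<partial>sphere_measure)"
    using inv_poisson_kernel_eq(1)[OF x]
    by (intro Bochner_Integration.integral_cong) (auto simp: mult.commute less_imp_le)
  finally show ?thesis .
qed

text \<open>For finite \<open>p\<close> this is Hoelder's inequality. For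
  \<open>p = \<infinity>\<close> the norm of \<phi> is bounded almost everywhere by its essential
  supremum \<open>E\<close>, and \<open>q = 1\<close>.\<close>

lemma norm_inv_poisson_integral_le_Lp:
  fixes x :: "real ^ 'n"
  assumes x: "norm x < 1" and \<phi>: "\<phi> \<in> Lp_sphere p"
    and pq: "1 < p" "1 \<le> q" "1 / p + 1 / ennreal q = 1"
  shows "norm (inv_poisson_integral \<phi> x)
    \<le> (\<integral>\<zeta>. inv_poisson_kernel x \<zeta> powr q \<partial>sphere_measure) powr (1 / q) * Lp_norm p \<phi>"
  using pq
proof (cases rule: conjugate_exponent_cases)
  case 1
  define E where "E = Lp_norm p \<phi>"
  have \<phi>m [measurable]: "\<phi> \<in> borel_measurable sphere_measure"
    and fin: "esssup sphere_measure (\<lambda>\<zeta>. ennreal (norm (\<phi> \<zeta>))) < \<infinity>"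
    using \<phi> 1 by (auto simp: Lp_sphere_def)
  have E: "esssup sphere_measure (\<lambda>\<zeta>. ennreal (norm (\<phi> \<zeta>))) = ennreal E" "E \<ge> 0"
    using fin 1 by (simp_all add: E_def Lp_norm_def)
  have AE: "AE \<zeta> in sphere_measure. norm (\<phi> \<zeta>) \<le> E"
    using esssup_AE[of "\<lambda>\<zeta>. ennreal (norm (\<phi> \<zeta>))" sphere_measure] E(2)
    unfolding E(1) by (simp add: ennreal_le_iff)
  have P: "inv_poisson_kernel x \<zeta> powr q = inv_poisson_kernel x \<zeta>" if "\<zeta> \<in> space sphere_measure" for \<zeta>
    using that inv_poisson_kernel_eq(1)[OF x, of \<zeta>] 1 by simp
  have int: "integrable sphere_measure (\<lambda>\<zeta>. E * inv_poisson_kernel x \<zeta>)"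
  proof (rule integrable_mult_right)
    have "integrable sphere_measure (\<lambda>\<zeta>. inv_poisson_kernel x \<zeta> powr q)"
      by (rule integrable_inv_poisson_kernel_powr[OF x]) (simp add: 1)
    moreover have "integrable sphere_measure (\<lambda>\<zeta>. inv_poisson_kernel x \<zeta> powr q)
        \<longleftrightarrow> integrable sphere_measure (inv_poisson_kernel x)"
      by (rule Bochner_Integration.integrable_cong) (simp_all add: P)
    ultimately show "integrable sphere_measure (inv_poisson_kernel x)"
      by simp
  qed
  have AE': "AE \<zeta> in sphere_measure. norm (\<phi> \<zeta>) * inv_poisson_kernel x \<zeta> \<le> E * inv_poisson_kernel x \<zeta>"
    and AE'': "AE \<zeta> in sphere_measure. 0 \<le> norm (\<phi> \<zeta>) * inv_poisson_kernel x \<zeta>"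
    using AE AE_space by (eventually_elim,
      use inv_poisson_kernel_eq(1)[OF x] in \<open>auto intro!: mult_right_mono simp: less_imp_le\<close>)+
  have "norm (inv_poisson_integral \<phi> x) \<le> (\<integral>\<zeta>. norm (\<phi> \<zeta>) * inv_poisson_kernel x \<zeta> \<partial>sphere_measure)"
    by (rule norm_inv_poisson_integral_le[OF x])
  also have "\<dots> \<le> (\<integral>\<zeta>. E * inv_poisson_kernel x \<zeta> \<partial>sphere_measure)"
  proof (rule integral_mono_AE[OF _ int AE'])
    show "integrable sphere_measure (\<lambda>\<zeta>. norm (\<phi> \<zeta>) * inv_poisson_kernel x \<zeta>)"
    proof (rule Bochner_Integration.integrable_bound[OF int])
      show "(\<lambda>\<zeta>. norm (\<phi> \<zeta>) * inv_poisson_kernel x \<zeta>) \<in> borel_measurable sphere_measure"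
        by (intro borel_measurable_times measurable_compose[OF \<phi>m borel_measurable_norm]
            borel_measurable_sphere_measure_inv_poisson_kernel)
      show "AE \<zeta> in sphere_measure. norm (norm (\<phi> \<zeta>) * inv_poisson_kernel x \<zeta>) \<le> norm (E * inv_poisson_kernel x \<zeta>)"
        using AE' AE'' by eventually_elim (auto intro: order_trans[OF _ abs_ge_self])
    qed
  qed
  also have "\<dots> = E * (\<integral>\<zeta>. inv_poisson_kernel x \<zeta> powr q \<partial>sphere_measure)"
  proof -
    have "(\<integral>\<zeta>. inv_poisson_kernel x \<zeta> powr q \<partial>sphere_measure) = (\<integral>\<zeta>. inv_poisson_kernel x \<zeta> \<partial>sphere_measure)"
      by (rule Bochner_Integration.integral_cong) (simp_all add: P)
    then show ?thesis by simp
  qed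
  finally show ?thesis
    using 1 by (simp add: E_def mult.commute)
next
  case (2 p')
  have \<phi>m [measurable]: "\<phi> \<in> borel_measurable sphere_measure"
    and int: "integrable sphere_measure (\<lambda>\<zeta>. norm (\<phi> \<zeta>) powr p')"
    using \<phi> 2 by (auto simp: Lp_sphere_def)
  have "norm (inv_poisson_integral \<phi> x) \<le> (\<integral>\<zeta>. norm (\<phi> \<zeta>) * inv_poisson_kernel x \<zeta> \<partial>sphere_measure)"
    by (rule norm_inv_poisson_integral_le[OF x])
  also have "\<dots> \<le> (\<integral>\<zeta>. norm (\<phi> \<zeta>) powr p' \<partial>sphere_measure) powr (1 / p')
      * (\<integral>\<zeta>. inv_poisson_kernel x \<zeta> powr q \<partial>sphere_measure) powr (1 / q)"
    using 2 inv_poisson_kernel_eq(1)[OF x] integrable_inv_poisson_kernel_powr[OF x, of q]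
    by (intro Holder_inequality_integral int) (auto simp: less_imp_le)
  finally show ?thesis
    using 2 by (simp add: Lp_norm_def mult.commute)
qed

text \<open>Test with \<phi> = P^(q - 1) e, P being the kernel at \<open>x\<close>. Then P \<phi> =
  P^q e integrates to \<open>I *\<^sub>R e\<close>, while for finite \<open>p\<close> the identity
  (q - 1) p = q gives \<phi> the norm I^(1/p). Hence I \<le> K I^(1/p), that is, I^(1/q) \<le> K.
  For \<open>q = 1\<close> the test function is the constant \<open>e\<close>.\<close>

lemma inv_poisson_integral_extremal:
  fixes x :: "real ^ 'n"
  assumes n3: "CARD('n) \<ge> 3" and x: "norm x < 1"
    and pq: "1 < p" "1 \<le> q" "1 / p + 1 / ennreal q = 1"
    and K: "\<And>\<phi>. \<phi> \<in> Lp_sphere p \<Longrightarrow> norm (inv_poisson_integral \<phi> x) \<le> K * Lp_norm p \<phi>"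
  shows "(\<integral>\<zeta>. inv_poisson_kernel x \<zeta> powr q \<partial>sphere_measure) powr (1 / q) \<le> K"
proof -
  interpret prob_space "sphere_measure :: (real ^ 'n) measure"
    by (rule prob_space_sphere_measure)
  define I where "I = (\<integral>\<zeta>. inv_poisson_kernel x \<zeta> powr q \<partial>sphere_measure)"
  have I: "I > 0"
    unfolding I_def by (rule integral_inv_poisson_kernel_powr(2)[OF n3 x])
  define e :: "real ^ 'n" where "e = axis undefined 1"
  have e: "norm e = 1" by (simp add: e_def)
  define \<phi> where "\<phi> \<zeta> = inv_poisson_kernel x \<zeta> powr (q - 1) *\<^sub>R e" for \<zeta>
  have [measurable]: "\<phi> \<in> borel_measurable sphere_measure"
    unfolding \<phi>_def[abs_def] by measurable
  have norm_\<phi>: "norm (\<phi> \<zeta>) = inv_poisson_kernel x \<zeta> powr (q - 1)" for \<zeta>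
    by (simp add: \<phi>_def e)
  have "inv_poisson_integral \<phi> x = (\<integral>\<zeta>. inv_poisson_kernel x \<zeta> powr q *\<^sub>R e \<partial>sphere_measure)"
    unfolding inv_poisson_integral_def
    by (intro Bochner_Integration.integral_cong)
      (use inv_poisson_kernel_eq(1)[OF x] in \<open>auto simp: \<phi>_def powr_mult_base less_imp_le\<close>)
  also have "\<dots> = I *\<^sub>R e"
    unfolding I_def using integrable_inv_poisson_kernel_powr[OF x, of q] pq(2)
    by (intro integral_scaleR_left) auto
  finally have norm_u: "norm (inv_poisson_integral \<phi> x) = I"
    using I by (simp add: e)
  have "I powr (1 / q) \<le> K"
    using pq
  proof (cases rule: conjugate_exponent_cases)
    case 1
    \<comment> \<open>A power with exponent 0 is 1 only for a nonzero base
      (\<open>0 powr 0 = 0\<close>), hence the appeal to positivity of the kernel.\<close>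
    have "norm (\<phi> \<zeta>) = 1" if "\<zeta> \<in> space sphere_measure" for \<zeta>
      using that inv_poisson_kernel_eq(1)[OF x, of \<zeta>] 1 by (simp add: norm_\<phi>)
    then have "esssup sphere_measure (\<lambda>\<zeta>. ennreal (norm (\<phi> \<zeta>))) = esssup (sphere_measure :: (real ^ 'n) measure) (\<lambda>\<zeta>. 1)"
      by (intro esssup_AE_cong) (auto intro!: AE_I2)
    also have "\<dots> = 1"
      by (rule esssup_const) (simp add: emeasure_space_1 del: space_sphere_measure)
    finally have L: "\<phi> \<in> Lp_sphere p" "Lp_norm p \<phi> = 1"
      using 1 by (simp_all add: Lp_sphere_def Lp_norm_def)
    from K[OF L(1)] show ?thesis
      using L(2) I 1 by (simp add: norm_u)
  next
    case (2 p')
    have "(q - 1) * p' = q"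
      using 2 by (simp add: field_simps)
    then have powr_\<phi>: "norm (\<phi> \<zeta>) powr p' = inv_poisson_kernel x \<zeta> powr q" for \<zeta>
      by (simp add: norm_\<phi> powr_powr)
    have L: "\<phi> \<in> Lp_sphere p" "Lp_norm p \<phi> = I powr (1 / p')"
      using 2 integrable_inv_poisson_kernel_powr[OF x, of q]
      by (simp_all add: Lp_sphere_def Lp_norm_def powr_\<phi> I_def)
    from K[OF L(1)] have "I \<le> K * I powr (1 / p')"
      using L(2) by (simp add: norm_u)
    moreover have "I = I powr (1 / q) * I powr (1 / p')"
      using I 2 by (simp add: add.commute flip: powr_add)
    moreover have "I powr (1 / p') > 0" using I by simp
    ultimately show ?thesis
      by (metis mult_le_cancel_right_pos)
  qed
  then show ?thesis
    by (simp only: I_def)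
qed

theorem theorem1p1:
  fixes p :: ennreal and q :: real
  assumes "CARD('n) \<ge> 3"
    and "1 < p"
    and "1 \<le> q"
    and "1 / p + 1 / ennreal q = 1"
  shows "(\<forall>\<phi> \<in> Lp_sphere p. \<forall>x \<in> ball (0 :: real ^ 'n) 1.
            norm (inv_poisson_integral \<phi> x) \<le> sharp_const p q x * Lp_norm p \<phi>) \<and>
         (\<forall>x \<in> ball (0 :: real ^ 'n) 1. \<forall>K :: real.
            (\<forall>\<phi> \<in> Lp_sphere p. norm (inv_poisson_integral \<phi> x) \<le> K * Lp_norm p \<phi>) \<longrightarrow>
            sharp_const p q x \<le> K)"
proof (intro conjI ballI allI impI)
  fix \<phi> :: "real ^ 'n \<Rightarrow> real ^ 'n" and x :: "real ^ 'n" assume "\<phi> \<in> Lp_sphere p" "x \<in> ball 0 1"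
  then show "norm (inv_poisson_integral \<phi> x) \<le> sharp_const p q x * Lp_norm p \<phi>"
    using norm_inv_poisson_integral_le_Lp[OF _ _ assms(2-4)] sharp_const_eq[OF assms(1) _ assms(2-4)] by simp
next
  fix x :: "real ^ 'n" and K :: real
  assume x: "x \<in> ball 0 1" and K: "\<forall>\<phi> \<in> Lp_sphere p. norm (inv_poisson_integral \<phi> x) \<le> K * Lp_norm p \<phi>"
  then show "sharp_const p q x \<le> K"
    using inv_poisson_integral_extremal[OF assms(1) _ assms(2-4), of x K] sharp_const_eq[OF assms(1) _ assms(2-4), of x]
    by simp
qed

end
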